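(* Let $c=\{c_n\}_{n\in\mathbb{Z}_+}$ be a sequence in the class $\mathcal{X}_+$. Then there exists a sequence $a=\{a_n\}_{n\in\mathbb{Z}}$ of complex numbers such that $|a_n|\le e^{c_{|n|}}$ for each $n\in\mathbb{Z}$ and the trigonometric series $\sum_{n=-\infty}^{\infty} a_n z^n$ is universal in $C_p(\mathbb{T})$; that is, $\mathcal{R}_a(\mathbb{T})=C(\mathbb{T})$.
   Context: $\mathbb{T}=\{z\in\mathbb{C}:|z|=1\}$; $\mathbb{Z}_+$ is the set of non-negative integers; $C(\mathbb{T})$ is the space of continuous complex-valued functions on $\mathbb{T}$, and $C_p(\mathbb{T})$ is $C(\mathbb{T})$ with the topology of pointwise convergence. Class $\mathcal{X}_+$: a sequence $\{c_n\}_{n\in\mathbb{Z}_+}$ of positive real numbers belongs to $\mathcal{X}_+$ if $\lim_{n\to\infty} n(c_{n+1}-c_n)=+\infty$ and $\sum_{n=0}^\infty \frac{c_n}{n^2+1}=\infty$. For a bilateral complex sequence $a=\{a_n\}_{n\in\mathbb{Z}}$ and $m\in\mathbb{Z}_+$, put $S^a_m(z)=\sum_{k=-m}^m a_k z^k$. $\mathcal{R}_a(\mathbb{T})$ is the set of all $g\in C(\mathbb{T})$ for which there is a strictly increasing sequence $\{m_k\}_{k\in\mathbb{Z}_+}$ of positive integers such that $S^a_{m_k}(z)\to g(z)$ as $k\to\infty$ for every $z\in\mathbb{T}$. The series $\sum_{n=-\infty}^\infty a_nz^n$ is universal in $C_p(\mathbb{T})$ if every $f\in C(\mathbb{T})$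 belongs to $\mathcal{R}_a(\mathbb{T})$. *)

theory Defs
  imports "HOL-Analysis.Analysis"
begin

abbreviation unit_circle :: "complex set" where
  "unit_circle \<equiv> sphere 0 1"

text \<open>An element of $C(\mathbb{T})$ is represented by any function on the complex plane that is
  continuous on the unit circle; its values off the circle are irrelevant (every notion below
  depends only on the values on the circle).\<close>

definition C_circle :: "(complex \<Rightarrow> complex) set" where
  "C_circle = {g. continuous_on unit_circle g}"

definition class_X_plus :: "(nat \<Rightarrow> real) set" where
  "class_X_plus = {c. (\<forall>n. 0 < c n)
     \<and> filterlim (\<lambda>n. real n * (c (Suc n) - c n)) at_top sequentially
     \<and> filterlim (\<lambda>N. \<Sum>n\<le>N. c n / (real n ^ 2 + 1)) at_top sequentially}"

definition trig_partial_sum :: "(int \<Rightarrow> complex) \<Rightarrow> nat \<Rightarrow> complex \<Rightarrow> complex" where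
  "trig_partial_sum a m z = (\<Sum>k = - int m..int m. a k * z powi k)"

definition limit_functions :: "(int \<Rightarrow> complex) \<Rightarrow> (complex \<Rightarrow> complex) set" where
  "limit_functions a = {g \<in> C_circle. \<exists>m :: nat \<Rightarrow> nat. strict_mono m \<and> (\<forall>k. 0 < m k)
     \<and> (\<forall>z \<in> unit_circle. (\<lambda>k. trig_partial_sum a (m k) z) \<longlonglongrightarrow> g z)}"

definition universal_trig_series :: "(int \<Rightarrow> complex) \<Rightarrow> bool" where
  "universal_trig_series a \<longleftrightarrow> (\<forall>f \<in> C_circle. f \<in> limit_functions a)"

end

(*
  The partial sums S_m of the series are built block by block. In step k the next block moves the
  partial sum close to a prescribed target, uniformly off an arc that shrinks to the point 1 without
  containing it, so that every point of the circle lies in only finitely many of the exceptional arcs.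
  The coefficient bounds enter through one approximation statement: on a proper closed arc J, every
  trigonometric polynomial is a uniform limit of trigonometric polynomials p with frequencies |n| > N
  and |p_n| <= exp (c_|n|). If this failed, duality would give a nonzero r on J whose Fourier
  coefficients are O(exp (- c_|n|)); as c increases and the sum of c_n / n^2 diverges, a function with
  such coefficients that vanishes on an arc is zero (Levinson). The latter is proved by
  letting smallness propagate from an arc to the circle through the scales of c.
*)
theory Submission
  imports Defs "HOL-Complex_Analysis.Complex_Analysis"
begin

section \<open>Smallness of trigonometric polynomials beyond an interval\<close>

text \<open>The divergence of the sum of c_n / n^2 is spent as follows. If c is of order k beyond
  degree N, the function is a polynomial of degree N up to an error of order 16^-k, and a three
  circle bound carries smallness 16^-k past the ends of an interval by a length of order k / N, at
  the price of a weaker base. Using k = 3^j, the lengths gained have an infinite sum, for otherwise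
  the sum of c_n / (n^2 + 1) would be finite. The obstacle in the duality step is that no limiting
  residual r is available: for a near-minimiser the coefficient bounds hold only up to some
  frequency M, and how good the minimiser must be depends on M. Uniqueness is therefore needed with
  a threshold that depends on the constants in the coefficient bound and not on the function; then M
  can be fixed before the near-minimiser, whose norm is bounded a priori. Duality is carried out in
  L2, where the distance can be varied along segments. Uniform closeness is recovered at the end by
  averaging over short intervals, an operation that never increases the modulus of a
  coefficient.\<close>

text \<open>Hadamard's three circle theorem, pulled back along the Joukowski map.\<close>

lemma three_circle_segment:
  fixes F :: "complex \<Rightarrow> complex"
  assumes hol: "F holomorphic_on UNIV" and h: "h > 0"
    and seg: "\<And>x. \<bar>x - c\<bar> \<le> h \<Longrightarrow> cmod (F (of_real x)) \<le> A / 16 ^ k"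
    and strip: "\<And>z. \<bar>Im z\<bar> \<le> 9 * h \<Longrightarrow> cmod (F z) \<le> A * 16 ^ k"
    and x: "\<bar>x - c\<bar> \<le> 5 / 4 * h"
  shows "cmod (F (of_real x)) \<le> A / 4 ^ k"
proof -
  have "0 \<le> A / 16 ^ k" using order_trans[OF norm_ge_zero seg[of c]] h by simp
  then have "0 \<le> A / 16 ^ k * 16 ^ k" by (intro mult_nonneg_nonneg) auto
  then have A: "A \<ge> 0" by simp
  define y where "y = (x - c) / h"
  have y: "\<bar>y\<bar> \<le> 5 / 4" and xy: "x = c + h * y"
    using x h by (auto simp: y_def field_simps abs_mult)
  show ?thesis
  proof (cases "\<bar>y\<bar> \<le> 1")
    case True
    then have "cmod (F (of_real x)) \<le> A / 16 ^ k"
      using h by (intro seg) (auto simp: y_def)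
    also have "\<dots> \<le> A / 4 ^ k" using A by (intro divide_left_mono power_mono) auto
    finally show ?thesis .
  next
    case False
    \<comment> \<open>\<open>r\<close> and \<open>s\<close> are the two positive solutions w of (w +
      1 / w) / 2 = \<bar>y\<bar>. The range 5 / 4 corresponds to \<open>r \<le> 2\<close>, as 5 / 4
      = (2 + 1 / 2) / 2.\<close>
    define r where "r = \<bar>y\<bar> + sqrt (y\<^sup>2 - 1)"
    define s where "s = \<bar>y\<bar> - sqrt (y\<^sup>2 - 1)"
    have y2: "y\<^sup>2 \<ge> 1" using False abs_le_square_iff[of 1 y] by simp
    have "y\<^sup>2 \<le> (5/4)\<^sup>2" using y by (metis abs_ge_zero power2_abs power_mono)
    then have "sqrt (y\<^sup>2 - 1) \<le> sqrt ((3/4)\<^sup>2)"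
      by (intro real_sqrt_le_mono) (simp add: power2_eq_square)
    then have r2: "r \<le> 2" using y by (simp add: r_def)
    have r1: "r > 1" using False real_sqrt_ge_zero[of "y\<^sup>2 - 1"] y2 unfolding r_def by linarith
    have "r * s = 1" using y2 by (simp add: r_def s_def algebra_simps power2_eq_square[symmetric])
    then have ir: "1 / r = s" using r1 by (simp add: field_simps)
    have rs: "(r + 1 / r) / 2 = \<bar>y\<bar>" unfolding ir by (simp add: r_def s_def)
    define w :: complex where "w = of_real (sgn y * r)"
    have sy: "sgn y = 1 \<or> sgn y = -1" using False by (auto simp: sgn_if)
    have w: "cmod w = r" using sy r1 by (auto simp: w_def)
    have Jw: "(w + 1 / w) / 2 = of_real y"
    proof -
      have "(w + 1 / w) / 2 = of_real (sgn y * ((r + 1 / r) / 2))"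
        using sy by (auto simp: w_def divide_simps)
      also have "\<dots> = of_real y" unfolding rs by (simp add: sgn_if abs_if)
      finally show ?thesis .
    qed
    define J where "J = (\<lambda>w::complex. of_real c + of_real h * ((w + 1 / w) / 2))"
    \<comment> \<open>The power of w equalises the two boundary bounds. \<open>J\<close> maps the
      unit circle to the segment, where the bound is A / 16^k. It maps the circle of radius 16 into
      the strip, as (16 + 1/16) / 2 \<le> 9, and there A * 16^k / 16^(2k) has the same
      value.\<close>
    define G where "G = (\<lambda>w. F (J w) / w ^ (2 * k))"
    define S :: "complex set" where "S = cball 0 16 - ball 0 1"
    have Shol: "G holomorphic_on - {0}"
    proof -
      have "F \<circ> J holomorphic_on - {0}"
        by (rule holomorphic_on_compose_gen[OF _ hol]) (auto simp: J_def intro!: holomorphic_intros)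
      then show ?thesis unfolding G_def o_def by (intro holomorphic_intros) auto
    qed
    have S0: "S \<subseteq> - {0}" by (auto simp: S_def)
    have clS: "closed S" by (auto simp: S_def intro: closed_Diff)
    have "cmod (G w) \<le> A / 16 ^ k"
    proof (rule maximum_modulus_frontier[of G S])
      show "G holomorphic_on interior S"
        using Shol S0 interior_subset by (blast intro: holomorphic_on_subset)
      show "continuous_on (closure S) G"
        using Shol S0 clS by (simp add: holomorphic_on_imp_continuous_on holomorphic_on_subset closure_closed)
      show "bounded S" unfolding S_def by (rule bounded_subset[OF bounded_cball]) auto
      show "w \<in> S" using r1 r2 w by (auto simp: S_def)
      fix z assume z: "z \<in> frontier S"
      have "frontier S \<subseteq> sphere 0 16 \<union> sphere 0 1"
      proof -
        have "open (ball 0 16 - cball (0::complex) 1)" by (intro open_Diff) auto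
        moreover have "ball 0 16 - cball (0::complex) 1 \<subseteq> S" by (auto simp: S_def)
        ultimately have "ball 0 16 - cball 0 1 \<subseteq> interior S" by (rule interior_maximal[rotated])
        then have "frontier S \<subseteq> S - (ball 0 16 - cball 0 1)"
          using clS by (auto simp: frontier_def closure_closed)
        then show ?thesis by (fastforce simp: S_def)
      qed
      then consider "cmod z = 1" | "cmod z = 16" using z by auto
      then show "cmod (G z) \<le> A / 16 ^ k"
      proof cases
        case 1
        then have "1 / z = cnj z" by (metis complex_div_cnj div_by_1 mult.left_neutral of_real_1 power_one)
        then have "(z + 1 / z) / 2 = of_real (Re z)" by (simp add: complex_eq_iff)
        then have J: "J z = of_real (c + h * Re z)" by (simp add: J_def)
        have "\<bar>Re z\<bar> \<le> 1" using abs_Re_le_cmod[of z] 1 by simp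
        then have "cmod (F (J z)) \<le> A / 16 ^ k"
          unfolding J using h by (intro seg) (auto simp: abs_mult)
        then show ?thesis using 1 by (simp add: G_def norm_divide norm_power)
      next
        case 2
        have "\<bar>Im ((z + 1 / z) / 2)\<bar> \<le> cmod ((z + 1 / z) / 2)" by (rule abs_Im_le_cmod)
        also have "\<dots> \<le> (cmod z + cmod (1 / z)) / 2" using norm_triangle_ineq[of z "1 / z"] by simp
        also have "\<dots> \<le> 9" using 2 by (simp add: norm_divide)
        finally have "\<bar>Im ((z + 1 / z) / 2)\<bar> \<le> 9" .
        moreover have "Im (J z) = h * Im ((z + 1 / z) / 2)" unfolding J_def
          by (simp only: plus_complex.sel Im_complex_of_real Re_complex_of_real times_complex.sel)
        ultimately have "\<bar>Im (J z)\<bar> \<le> h * 9"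
          using h by (simp only: abs_mult abs_of_pos) (rule mult_left_mono, auto)
        then have "\<bar>Im (J z)\<bar> \<le> 9 * h" by simp
        then have "cmod (F (J z)) \<le> A * 16 ^ k" by (rule strip)
        then have "cmod (G z) \<le> A * 16 ^ k / 16 ^ (2 * k)"
          using 2 by (simp add: G_def norm_divide norm_power divide_right_mono)
        also have "\<dots> = A / 16 ^ k" by (simp add: mult_2 power_add)
        finally show ?thesis .
      qed
    qed
    then have "cmod (F (J w)) \<le> A / 16 ^ k * r ^ (2 * k)"
      using r1 w by (simp add: G_def norm_divide norm_power field_simps)
    also have "\<dots> \<le> A / 16 ^ k * 2 ^ (2 * k)" using A r1 r2 by (intro mult_left_mono power_mono) auto
    also have "\<dots> = A / 4 ^ k"
    proof -
      have "(16::real) ^ k = 4 ^ k * 4 ^ k" by (simp flip: power_mult_distrib)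
      then show ?thesis by (simp add: power_mult)
    qed
    finally show ?thesis unfolding J_def Jw xy by simp
  qed
qed

text \<open>The variable is the angle and may be complex: a trigonometric polynomial becomes an
  entire function that can be bounded on strips around the real line.\<close>

definition trig :: "(int \<Rightarrow> complex) \<Rightarrow> nat \<Rightarrow> complex \<Rightarrow> complex" where
  "trig a m z = (\<Sum>n = - int m..int m. a n * exp (\<i> * of_int n * z))"

lemma trig_holomorphic: "trig a m holomorphic_on S"
  unfolding trig_def by (intro holomorphic_intros)

lemma trig_diff: "trig (\<lambda>n. a n - b n) m z = trig a m z - trig b m z"
  by (simp add: trig_def sum_subtractf algebra_simps)

lemma norm_trig_le: "cmod (trig a m (of_real t)) \<le> (\<Sum>n = - int m..int m. cmod (a n))"
  unfolding trig_def by (rule sum_norm_le) (simp add: norm_mult)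

text \<open>Without its tail the function has degree at most N, so on the strip of half-width 9 h it
  grows by a factor at most exp (9 h N) \<le> exp (9 k / 4) \<le> 16^k, the growth that
  \<open>three_circle_segment\<close> admits. Restoring the tail turns the constant 1 into 3 /
  2.\<close>

lemma small_on_interval_extend:
  fixes a :: "int \<Rightarrow> complex" and N m k :: nat
  assumes total: "(\<Sum>n = - int m..int m. cmod (a n)) \<le> A"
    and tail: "(\<Sum>n \<in> {n \<in> {- int m..int m}. int N < \<bar>n\<bar>}. cmod (a n)) \<le> A / 2 / 16 ^ k"
    and small: "\<And>t. t \<in> {\<alpha>..\<beta>} \<Longrightarrow> cmod (trig a m (of_real t)) \<le> A / 2 / 16 ^ k"
    and h: "0 < h" "2 * h \<le> \<beta> - \<alpha>" "4 * h * N \<le> k"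
    and t: "t \<in> {\<alpha> - h / 4..\<beta> + h / 4}"
  shows "cmod (trig a m (of_real t)) \<le> 3 / 2 * A / 4 ^ k"
proof -
  have A: "A \<ge> 0" using total by (meson norm_ge_zero order_trans sum_nonneg)
  define p where "p = (\<lambda>n. if \<bar>n\<bar> \<le> int N then a n else 0)"
  have diff: "cmod (trig a m (of_real t) - trig p m (of_real t)) \<le> A / 2 / 16 ^ k" for t :: real
  proof -
    have "cmod (trig a m (of_real t) - trig p m (of_real t)) \<le> (\<Sum>n = - int m..int m. cmod (a n - p n))"
      unfolding trig_diff[symmetric] by (rule norm_trig_le)
    also have "\<dots> = (\<Sum>n \<in> {n \<in> {- int m..int m}. int N < \<bar>n\<bar>}. cmod (a n))"
      by (rule sum.mono_neutral_cong_right) (auto simp: p_def)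
    finally show ?thesis using tail by linarith
  qed
  have pseg: "cmod (trig p m (of_real t)) \<le> A / 16 ^ k" if "t \<in> {\<alpha>..\<beta>}" for t
    using small[OF that] diff[of t] norm_triangle_sub[of "trig p m (of_real t)" "trig a m (of_real t)"]
    by (simp add: norm_minus_commute)
  have pstrip: "cmod (trig p m z) \<le> A * 16 ^ k" if z: "\<bar>Im z\<bar> \<le> 9 * h" for z
  proof -
    have "cmod (trig p m z) \<le> (\<Sum>n = - int m..int m. cmod (a n) * 16 ^ k)"
      unfolding trig_def
    proof (rule sum_norm_le)
      fix n assume "n \<in> {- int m..int m}"
      show "cmod (p n * exp (\<i> * of_int n * z)) \<le> cmod (a n) * 16 ^ k"
      proof (cases "\<bar>n\<bar> \<le> int N")
        case True
        have "- (of_int n * Im z) \<le> \<bar>of_int n\<bar> * \<bar>Im z\<bar>"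
          by (metis abs_ge_minus_self abs_mult)
        also have "\<dots> \<le> real N * (9 * h)" using True z by (intro mult_mono) auto
        also have "\<dots> \<le> 9 / 4 * real k" using h by (simp add: algebra_simps)
        finally have "exp (- (of_int n * Im z)) \<le> exp (9 / 4 * real k)" by simp
        also have "\<dots> = exp (9 / 4) ^ k" by (simp add: exp_of_nat_mult[symmetric] mult.commute)
        also have "\<dots> \<le> 16 ^ k"
        proof (rule power_mono)
          have "exp (9/4 :: real) \<le> exp (1/4 * real 9)" by simp
          also have "\<dots> = exp (1/4) ^ 9" by (metis exp_of_nat_mult mult.commute)
          also have "\<dots> \<le> (21/16) ^ 9"
          proof (rule power_mono)
            show "exp (1/4 :: real) \<le> 21/16" using exp_bound[of "1/4"] by (simp add: power2_eq_square)
          qed auto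
          also have "\<dots> \<le> (16::real)" by (simp add: power_numeral field_simps)
          finally show "exp (9/4 :: real) \<le> 16" .
        qed auto
        finally show ?thesis using True by (simp add: p_def norm_mult mult_left_mono)
      qed (simp add: p_def)
    qed
    also have "\<dots> \<le> A * 16 ^ k" using total by (simp add: sum_distrib_right[symmetric])
    finally show ?thesis .
  qed
  have "cmod (trig p m (of_real t)) \<le> A / 4 ^ k"
  proof -
    \<comment> \<open>The centre of a subinterval of half-length \<open>h\<close>, as close to t as
      the ends permit; t lies within h + h / 4 of it.\<close>
    define x0 where "x0 = (if t < \<alpha> + h then \<alpha> + h else if t > \<beta> - h then \<beta> - h else t)"
    show ?thesis
    proof (rule three_circle_segment[where F = "trig p m" and h = h and c = x0])
      show "trig p m holomorphic_on UNIV" by (rule trig_holomorphic)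
      show "\<And>x. \<bar>x - x0\<bar> \<le> h \<Longrightarrow> cmod (trig p m (of_real x)) \<le> A / 16 ^ k"
        using h by (intro pseg) (auto simp: x0_def split: if_splits)
      show "\<bar>t - x0\<bar> \<le> 5 / 4 * h" using t h by (auto simp: x0_def split: if_splits)
    qed (use h pstrip in auto)
  qed
  moreover have "A / 2 / 16 ^ k \<le> A / 2 / 4 ^ k"
    using A by (intro divide_left_mono power_mono) auto
  ultimately show ?thesis
    using diff[of t] norm_triangle_sub[of "trig a m (of_real t)" "trig p m (of_real t)"] by simp
qed

section \<open>Scales of the coefficient bound\<close>

text \<open>Raabe's test: the quotient of consecutive terms is the exponential of half an increment
  of c, and n times the increments tends to infinity. The exponent is halved because exp (- c) will
  be split into two such factors, one for convergence and one for the smallness of tails. It also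
  follows that c tends to infinity.\<close>

lemma class_X_plus_summable:
  assumes "c \<in> class_X_plus"
  shows "summable (\<lambda>n. exp (- c n / 2))"
proof (rule raabes_test_convergence)
  have lim: "filterlim (\<lambda>n. real n * (c (Suc n) - c n)) at_top sequentially"
    using assms by (simp add: class_X_plus_def)
  show "\<forall>\<^sub>F n in sequentially. 0 < exp (- c n / 2)" by simp
  have "filterlim (\<lambda>n. (1 / 2) * (real n * (c (Suc n) - c n))) at_top sequentially"
    by (rule filterlim_tendsto_pos_mult_at_top[OF tendsto_const _ lim]) simp
  then have "filterlim (\<lambda>n. real n * (exp (- c n / 2) / exp (- c (Suc n) / 2) - 1)) at_top sequentially"
  proof (rule filterlim_at_top_mono, intro always_eventually allI)
    fix n
    have "(c (Suc n) - c n) / 2 \<le> exp ((c (Suc n) - c n) / 2) - 1"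
      using exp_ge_add_one_self[of "(c (Suc n) - c n) / 2"] by linarith
    then have "real n * ((c (Suc n) - c n) / 2) \<le> real n * (exp ((c (Suc n) - c n) / 2) - 1)"
      by (rule mult_left_mono) simp
    moreover have "exp (- c n / 2) / exp (- c (Suc n) / 2) = exp ((c (Suc n) - c n) / 2)"
      by (simp add: exp_diff[symmetric] diff_divide_distrib)
    ultimately show "1 / 2 * (real n * (c (Suc n) - c n)) \<le> real n * (exp (- c n / 2) / exp (- c (Suc n) / 2) - 1)"
      by simp
  qed
  then have "(\<lambda>n. ereal (real n * (exp (- c n / 2) / exp (- c (Suc n) / 2) - 1))) \<longlonglongrightarrow> \<infinity>"
    by (simp add: tendsto_PInfty_eq_at_top)
  then show "1 < liminf (\<lambda>n. ereal (real n * (exp (- c n / 2) / exp (- c (Suc n) / 2) - 1)))"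
    by (simp add: lim_imp_Liminf)
qed

lemma sum_symmetric_le:
  fixes g :: "nat \<Rightarrow> real"
  assumes "\<And>n. 0 \<le> g n"
  shows "(\<Sum>k = - int m..int m. g (nat \<bar>k\<bar>)) \<le> 2 * (\<Sum>n\<le>m. g n)"
proof (induction m)
  case (Suc m)
  have "{- int (Suc m)..int (Suc m)} = insert (- int (Suc m)) (insert (int (Suc m)) {- int m..int m})"
    by auto
  with Suc show ?case by (simp add: nat_add_distrib)
qed (use assms in simp)

lemma sum_inverse_squares_le:
  assumes "p \<ge> 1"
  shows "(\<Sum>n = p..q. 1 / (real n ^ 2 + 1)) \<le> 2 / real p"
proof -
  have le: "1 / (real n ^ 2 + 1) \<le> 2 / real n - 2 / real (Suc n)" if "n \<ge> 1" for n
  proof -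
    have "real n * real (Suc n) \<le> 2 * (real n ^ 2 + 1)"
      using zero_le_power2[of "real n - 1"] by (simp add: power2_eq_square algebra_simps)
    then have "2 / (2 * (real n ^ 2 + 1)) \<le> 2 / (real n * real (Suc n))"
      using that by (intro divide_left_mono) (auto intro!: mult_pos_pos add_nonneg_pos)
    moreover have "2 / real n - 2 / real (Suc n) = 2 / (real n * real (Suc n))"
      using that by (simp add: field_simps)
    moreover have "2 / (2 * (real n ^ 2 + 1)) = 1 / (real n ^ 2 + 1)" by (rule mult_divide_mult_cancel_left[of 2 1, simplified mult_1_right]) simp
    ultimately show ?thesis by simp
  qed
  have "(\<Sum>n = p..q. 1 / (real n ^ 2 + 1)) \<le> 2 / real p - 2 / real (Suc q)" if "p \<le> q"
    using that
  proof (induction q rule: dec_induct)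
    case base
    show ?case using le[OF assms] by simp
  next
    case (step q)
    show ?case using step le[of "Suc q"] by simp
  qed
  then show ?thesis by (cases "p \<le> q") (auto intro: order_trans)
qed

text \<open>
  The scales are cut out by the level sets of \<open>c\<close> rather than dyadically, because \<open>c\<close> is only
  eventually monotone and may stay constant over long stretches.\<close>

lemma class_X_plus_scales:
  fixes D :: real
  assumes c: "c \<in> class_X_plus" and D: "D > 0"
  obtains N :: "nat \<Rightarrow> nat"
  where "\<And>j. N j \<ge> 1" "\<And>j. D * 3 ^ j \<le> real (N j)" "\<And>j n. N j \<le> n \<Longrightarrow> 8 * 3 ^ j \<le> c n"
    "\<not> summable (\<lambda>j. 3 ^ j / real (N j))"
proof -
  have cpos: "c n > 0" for n using c by (simp add: class_X_plus_def)
  have "eventually (\<lambda>n. real n * (c (Suc n) - c n) \<ge> 0) sequentially"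
    using c by (simp add: class_X_plus_def filterlim_at_top)
  then obtain n0 where n0: "\<And>n. n \<ge> n0 \<Longrightarrow> real n * (c (Suc n) - c n) \<ge> 0"
    by (auto simp: eventually_sequentially)
  \<comment> \<open>The successor makes the index positive, so that n (c (n + 1) - c n) \<ge> 0
    determines the sign of the increment.\<close>
  define n1 where "n1 = Suc n0"
  have mono: "c p \<le> c q" if "n1 \<le> p" "p \<le> q" for p q
    using that(2)
  proof (induction q rule: dec_induct)
    case (step q)
    then have "c q \<le> c (Suc q)" using n0[of q] that(1) by (simp add: n1_def zero_le_mult_iff)
    with step show ?case by simp
  qed simp
  have large: "\<exists>n. n \<ge> m \<and> X \<le> c n" for X m
  proof -
    have "(\<lambda>n. exp (- c n / 2)) \<longlonglongrightarrow> 0" using class_X_plus_summable[OF c] by (rule summable_LIMSEQ_zero)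
    then have "eventually (\<lambda>n. exp (- c n / 2) < exp (- X / 2)) sequentially"
      by (rule order_tendstoD) simp
    then have "eventually (\<lambda>n. exp (- c n / 2) < exp (- X / 2) \<and> n \<ge> m) sequentially"
      using eventually_ge_at_top[of m] by (rule eventually_conj)
    then obtain n where "exp (- c n / 2) < exp (- X / 2) \<and> n \<ge> m"
      by (auto simp: eventually_sequentially)
    then show ?thesis by (intro exI[of _ n]) simp
  qed
  \<comment> \<open>The condition on D keeps 3^j / N j below 1 / D, which later prevents a single
    enlargement from being too long for the arc. It also complicates the divergence proof, since
    \<open>Q\<close> may fail because of it and not because c is small.\<close>
  define Q where "Q = (\<lambda>j n. n1 \<le> n \<and> D * 3 ^ j \<le> real n \<and> 8 * 3 ^ j \<le> c n)"
  define N where "N = (\<lambda>j. LEAST n. Q j n)"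
  have QN: "Q j (N j)" for j
  proof -
    obtain m where m: "D * 3 ^ j \<le> real m" using real_arch_simple by blast
    obtain n where "n \<ge> max m n1" "8 * 3 ^ j \<le> c n" using large by blast
    then have "Q j n" using m by (simp add: Q_def)
    then show ?thesis unfolding N_def by (rule LeastI)
  qed
  show ?thesis
  proof (rule that[of N])
    show "N j \<ge> 1" for j using QN[of j] by (simp add: Q_def n1_def)
    show "D * 3 ^ j \<le> real (N j)" for j using QN[of j] by (simp add: Q_def)
    show "8 * 3 ^ j \<le> c n" if "N j \<le> n" for j n
      using QN[of j] mono[of "N j" n] that by (simp add: Q_def)
    show "\<not> summable (\<lambda>j. 3 ^ j / real (N j))"
    proof
      assume sm: "summable (\<lambda>j. 3 ^ j / real (N j))"
      define T where "T = (\<Sum>j. 3 ^ j / real (N j))"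
      have "(\<lambda>j. 3 ^ j / real (N j)) \<longlonglongrightarrow> 0" using sm by (rule summable_LIMSEQ_zero)
      then have "eventually (\<lambda>j. 3 ^ j / real (N j) < 1 / (3 * D)) sequentially"
        by (rule order_tendstoD) (use D in simp)
      then obtain j0 where j0: "\<And>j. j \<ge> j0 \<Longrightarrow> 3 ^ j / real (N j) < 1 / (3 * D)"
        by (auto simp: eventually_sequentially)
      obtain n2 where n2: "real n2 \<ge> 3 * D * 3 ^ j0" using real_arch_simple by blast
      define n3 where "n3 = max n1 n2"
      have n3: "n3 \<ge> 1" by (simp add: n3_def n1_def)
      \<comment> \<open>Beyond \<open>n3\<close>, c is dominated by 8 plus a step function with jump
        24 * 3^j at each N j. Summed against 1 / (n^2 + 1) this gives at most 16 + 48 T,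
        contradicting divergence.\<close>
      have bound: "c n \<le> 8 + (\<Sum>j<L. if N j \<le> n then 24 * 3 ^ j else 0)"
        if n: "n3 \<le> n" and L: "N L > n" for n L
      proof -
        \<comment> \<open>\<open>Q i n\<close> fails by minimality of \<open>N i\<close>. For i = j
          + 1 the failure must be due to c: if j \<ge> j0, then N j > D * 3^i already, and smaller j
          are covered by n \<ge> n2. Hence c n < 8 * 3^i = 24 * 3^j.\<close>
        define i where "i = (LEAST j. N j > n)"
        have iN: "N i > n" unfolding i_def using L by (rule LeastI)
        have iL: "i \<le> L" unfolding i_def using L by (rule Least_le)
        have nQ: "\<not> Q i n" using iN not_less_Least unfolding N_def by blast
        have nn: "real n \<ge> real n2" "n \<ge> n1" using n by (auto simp: n3_def)
        have pos: "0 \<le> (\<Sum>j<L. if N j \<le> n then 24 * 3 ^ j else (0::real))" by (intro sum_nonneg) auto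
        show ?thesis
        proof (cases i)
          case 0
          have "D * 1 \<le> D * (3 * 3 ^ j0)"
            using D one_le_power[of "3::real" "Suc j0"] by (intro mult_left_mono) auto
          then have "D \<le> 3 * D * 3 ^ j0" by simp
          then have "D \<le> real n" using nn n2 by linarith
          then have "c n < 8" using nQ nn 0 by (auto simp: Q_def)
          then show ?thesis using pos by linarith
        next
          case (Suc j)
          have Nj: "N j \<le> n" using not_less_Least[of j "\<lambda>j. N j > n"] Suc unfolding i_def by auto
          have "D * 3 ^ i \<le> real n"
          proof (rule ccontr)
            assume "\<not> D * 3 ^ i \<le> real n"
            then have less: "real n < 3 * D * 3 ^ j" using Suc by simp
            then have "3 * D * 3 ^ j0 < 3 * D * 3 ^ j" using nn n2 by linarith
            then have "j0 \<le> j" using D by simp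
            then have "3 ^ j / real (N j) < 1 / (3 * D)" by (rule j0)
            then have "3 ^ j * (3 * D) < real (N j)"
              using D QN[of j] by (simp add: field_simps Q_def n1_def)
            then show False using less Nj by (simp add: mult_ac)
          qed
          then have "c n < 24 * 3 ^ j" using nQ nn Suc by (auto simp: Q_def)
          also have "24 * 3 ^ j = (if N j \<le> n then 24 * 3 ^ j else (0::real))" using Nj by simp
          also have "\<dots> \<le> (\<Sum>j<L. if N j \<le> n then 24 * 3 ^ j else 0)"
            using iL Suc by (intro member_le_sum) auto
          finally show ?thesis by simp
        qed
      qed
      define B where "B = (\<Sum>n<n3. c n / (real n ^ 2 + 1)) + 16 + 48 * T"
      have "(\<Sum>n\<le>X. c n / (real n ^ 2 + 1)) \<le> B" for X
      proof -
        obtain L where L: "real X / D < 3 ^ L" using real_arch_pow[of 3] by auto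
        then have "real X < D * 3 ^ L" using D by (simp add: field_simps)
        then have NL: "N L > X" using QN[of L] by (simp add: Q_def)
        have "(\<Sum>n = n3..X. c n / (real n ^ 2 + 1))
            \<le> (\<Sum>n = n3..X. (8 + (\<Sum>j<L. if N j \<le> n then 24 * 3 ^ j else 0)) / (real n ^ 2 + 1))"
          using NL by (intro sum_mono divide_right_mono bound) auto
        also have "\<dots> = 8 * (\<Sum>n = n3..X. 1 / (real n ^ 2 + 1))
            + (\<Sum>n = n3..X. (\<Sum>j<L. (if N j \<le> n then 24 * 3 ^ j / (real n ^ 2 + 1) else 0)))"
          by (simp add: add_divide_distrib sum.distrib sum_distrib_left sum_divide_distrib)
            (intro sum.cong refl, auto)
        also have "(\<Sum>n = n3..X. (\<Sum>j<L. (if N j \<le> n then 24 * 3 ^ j / (real n ^ 2 + 1) else 0)))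
            = (\<Sum>j<L. \<Sum>n = n3..X. (if N j \<le> n then 24 * 3 ^ j / (real n ^ 2 + 1) else 0))"
          by (rule sum.swap)
        also have "\<dots> \<le> (\<Sum>j<L. 48 * (3 ^ j / real (N j)))"
        proof (rule sum_mono)
          fix j
          have Nj1: "N j \<ge> 1" using QN[of j] by (simp add: Q_def n1_def)
          have "(\<Sum>n = n3..X. (if N j \<le> n then 24 * 3 ^ j / (real n ^ 2 + 1) else 0))
              \<le> (\<Sum>n = N j..X. 24 * 3 ^ j / (real n ^ 2 + 1))"
          proof -
            have "(\<Sum>n = n3..X. (if N j \<le> n then 24 * 3 ^ j / (real n ^ 2 + 1) else 0))
              = (\<Sum>n \<in> {n\<in>{n3..X}. N j \<le> n}. 24 * 3 ^ j / (real n ^ 2 + 1))"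
              by (rule sum.mono_neutral_cong_right) auto
            also have "\<dots> \<le> (\<Sum>n = N j..X. 24 * 3 ^ j / (real n ^ 2 + 1))"
              by (intro sum_mono2) auto
            finally show ?thesis .
          qed
          also have "\<dots> = 24 * 3 ^ j * (\<Sum>n = N j..X. 1 / (real n ^ 2 + 1))"
            by (simp add: sum_distrib_left)
          also have "\<dots> \<le> 24 * 3 ^ j * (2 / real (N j))"
            by (intro mult_left_mono sum_inverse_squares_le Nj1) auto
          finally show "(\<Sum>n = n3..X. (if N j \<le> n then 24 * 3 ^ j / (real n ^ 2 + 1) else 0))
              \<le> 48 * (3 ^ j / real (N j))" by simp
        qed
        also have "\<dots> = 48 * (\<Sum>j<L. 3 ^ j / real (N j))" by (simp add: sum_distrib_left)
        also have "\<dots> \<le> 48 * T"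
          unfolding T_def by (intro mult_left_mono sum_le_suminf sm) auto
        also have "8 * (\<Sum>n = n3..X. 1 / (real n ^ 2 + 1)) \<le> 8 * (2 / real n3)"
          by (intro mult_left_mono sum_inverse_squares_le n3) auto
        also have "8 * (2 / real n3) \<le> 16" using n3 by (simp add: divide_le_eq)
        finally have "(\<Sum>n = n3..X. c n / (real n ^ 2 + 1)) \<le> 16 + 48 * T" by simp
        moreover have "(\<Sum>n\<le>X. c n / (real n ^ 2 + 1))
            \<le> (\<Sum>n \<in> {..<n3} \<union> {n3..X}. c n / (real n ^ 2 + 1))"
          by (intro sum_mono2) (auto simp: less_imp_le[OF cpos] intro!: divide_nonneg_nonneg)
        moreover have "\<dots> = (\<Sum>n<n3. c n / (real n ^ 2 + 1)) + (\<Sum>n = n3..X. c n / (real n ^ 2 + 1))"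
          by (rule sum.union_disjoint) auto
        ultimately show ?thesis by (simp add: B_def)
      qed
      moreover have "eventually (\<lambda>X. B + 1 \<le> (\<Sum>n\<le>X. c n / (real n ^ 2 + 1))) sequentially"
        using c by (simp add: class_X_plus_def filterlim_at_top)
      then obtain X where "B + 1 \<le> (\<Sum>n\<le>X. c n / (real n ^ 2 + 1))"
        by (auto simp: eventually_sequentially)
      ultimately show False by (meson add_le_same_cancel1 not_one_le_zero order_trans)
    qed
  qed
qed

section \<open>A quantitative uniqueness theorem\<close>

text \<open>
  Smallness on an arc spreads: at the scale \<open>N j\<close> the function is, up to a small tail, a
  polynomial of degree \<open>N j\<close>, and the arc on which it is small may be enlarged by a multiple of
  \<open>3 ^ j / N j\<close>. Running through the scales from fine to coarse, the sum of these enlargements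
  exceeds the length of the circle. This is a quantitative form of Levinson's theorem.\<close>

lemma small_on_arc_imp_small:
  fixes \<alpha> \<beta> B \<eta> :: real
  assumes c: "c \<in> class_X_plus" and ab: "\<alpha> < \<beta>" and B: "B > 0" and \<eta>: "\<eta> > 0"
  obtains \<tau> where "\<tau> > 0"
    "\<And>a m t. \<lbrakk>\<forall>n \<in> {- int m..int m}. cmod (a n) \<le> B * exp (- c (nat \<bar>n\<bar>));
        \<forall>t \<in> {\<alpha>..\<beta>}. cmod (trig a m (of_real t)) \<le> \<tau>; t \<in> {\<alpha>..\<alpha> + 2 * pi}\<rbrakk>
      \<Longrightarrow> cmod (trig a m (of_real t)) \<le> \<eta>"
proof -
  define w where "w = (\<lambda>n. exp (- c n / 2))"
  define W where "W = 2 * (\<Sum>n. w n)"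
  have sw: "summable w" unfolding w_def by (rule class_X_plus_summable[OF c])
  have W: "W > 0" unfolding W_def using suminf_pos[OF sw] by (simp add: w_def)
  have sumw: "(\<Sum>n = - int m..int m. w (nat \<bar>n\<bar>)) \<le> W" for m
  proof -
    have "(\<Sum>n = - int m..int m. w (nat \<bar>n\<bar>)) \<le> 2 * (\<Sum>n\<le>m. w n)"
      by (rule sum_symmetric_le) (simp add: w_def)
    also have "\<dots> \<le> W" unfolding W_def
      by (intro mult_left_mono sum_le_suminf sw) (auto simp: w_def)
    finally show ?thesis .
  qed
  have cw: "exp (- c n) \<le> w n" for n
    using c by (simp add: w_def class_X_plus_def less_imp_le)
  \<comment> \<open>The factor 2 turns the tail bound B W / 16^3^j into the A / 2 / 16^k that
    \<open>small_on_interval_extend\<close> asks for.\<close>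
  define A where "A = 2 * B * W"
  have A: "A > 0" using B W by (simp add: A_def)
  have D: "1 / (2 * (\<beta> - \<alpha>)) > 0" using ab by simp
  obtain N :: "nat \<Rightarrow> nat"
    where N1: "\<And>j. N j \<ge> 1" and ND: "\<And>j. 1 / (2 * (\<beta> - \<alpha>)) * 3 ^ j \<le> real (N j)"
      and Nc: "\<And>j n. N j \<le> n \<Longrightarrow> 8 * 3 ^ j \<le> c n"
      and Nsum: "\<not> summable (\<lambda>j. 3 ^ j / real (N j))"
    by (rule class_X_plus_scales[OF c D]) blast
  \<comment> \<open>The largest value allowed by 4 h N \<le> k for k = 3^j. The choice D = 1 / (2
    (\<beta> - \<alpha>)) ensures 2 h j \<le> \<beta> - \<alpha> at every scale; the intervals met
    later are at least as long.\<close>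
  define h where "h = (\<lambda>j. 3 ^ j / (4 * real (N j)))"
  have h0: "h j > 0" for j using N1[of j] by (simp add: h_def)
  have hab: "2 * h j \<le> \<beta> - \<alpha>" for j
    using ND[of j] N1[of j] ab by (simp add: h_def field_simps)
  have hN: "4 * h j * real (N j) \<le> real (3 ^ j)" for j using N1[of j] by (simp add: h_def)
  have "\<not> summable h"
  proof
    assume "summable h"
    then have "summable (\<lambda>j. 4 * h j)" by (rule summable_mult)
    then show False using Nsum by (simp add: h_def)
  qed
  then have unbounded: "\<exists>K. sum h {..<K} > X" for X
    using summableI_nonneg_bounded[of h X] h0 by (meson less_imp_le not_le)
  \<comment> \<open>The threshold becomes independent of a and m through the order of choices:
    \<eta> fixes the coarsest scale J, divergence of the sum of \<open>h\<close> then fixes the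
    finest scale K, and \<tau> is the smallness required at scale K.\<close>
  obtain J where J: "A / \<eta> < 16 ^ J" using real_arch_pow[of 16] by auto
  have J\<eta>: "A / 16 ^ 3 ^ J \<le> \<eta>"
  proof -
    have "J \<le> 3 ^ J" by (rule less_imp_le, rule less_exp[THEN order_less_le_trans]) (simp add: power_mono)
    then have "(16::real) ^ J \<le> 16 ^ 3 ^ J" by (intro power_increasing) auto
    then have "A / \<eta> < 16 ^ 3 ^ J" using J by linarith
    then show ?thesis using \<eta> by (simp add: field_simps)
  qed
  obtain K where K: "sum h {..<K} > sum h {..J} + 8 * pi" using unbounded by blast
  have "sum h {..<K} \<le> sum h ({..J} \<union> {J<..K})"
    by (intro sum_mono2) (auto simp: less_imp_le[OF h0])
  also have "\<dots> = sum h {..J} + sum h {J<..K}" by (rule sum.union_disjoint) auto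
  finally have KJ: "sum h {J<..K} > 8 * pi" using K by simp
  then have JK: "J \<le> K" using pi_gt_zero by (cases "J \<le> K") auto
  show ?thesis
  proof (rule that[of "A / 2 / 16 ^ 3 ^ K"])
    show "A / 2 / 16 ^ 3 ^ K > 0" using A by simp
    fix a m t
    assume bd: "\<forall>n \<in> {- int m..int m}. cmod (a n) \<le> B * exp (- c (nat \<bar>n\<bar>))"
      and small: "\<forall>t \<in> {\<alpha>..\<beta>}. cmod (trig a m (of_real t)) \<le> A / 2 / 16 ^ 3 ^ K"
      and t: "t \<in> {\<alpha>..\<alpha> + 2 * pi}"
    have total: "(\<Sum>n = - int m..int m. cmod (a n)) \<le> A"
    proof -
      have "(\<Sum>n = - int m..int m. cmod (a n)) \<le> (\<Sum>n = - int m..int m. B * w (nat \<bar>n\<bar>))"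
      proof (rule sum_mono)
        fix n assume "n \<in> {- int m..int m}"
        then show "cmod (a n) \<le> B * w (nat \<bar>n\<bar>)"
          using bd mult_left_mono[OF cw[of "nat \<bar>n\<bar>"] less_imp_le[OF B]] by (blast intro: order_trans)
      qed
      also have "\<dots> \<le> B * W" using sumw[of m] B by (simp add: sum_distrib_left[symmetric])
      also have "\<dots> \<le> A" using B W by (simp add: A_def)
      finally show ?thesis .
    qed
    have tail: "(\<Sum>n \<in> {n \<in> {- int m..int m}. int (N j) < \<bar>n\<bar>}. cmod (a n)) \<le> A / 2 / 16 ^ 3 ^ j" for j
    proof -
      have "(\<Sum>n \<in> {n \<in> {- int m..int m}. int (N j) < \<bar>n\<bar>}. cmod (a n))
          \<le> (\<Sum>n \<in> {n \<in> {- int m..int m}. int (N j) < \<bar>n\<bar>}. B / 16 ^ 3 ^ j * w (nat \<bar>n\<bar>))"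
      proof (rule sum_mono)
        fix n assume n: "n \<in> {n \<in> {- int m..int m}. int (N j) < \<bar>n\<bar>}"
        define l where "l = nat \<bar>n\<bar>"
        have "8 * 3 ^ j \<le> c l" using n by (intro Nc) (auto simp: l_def)
        then have "w l \<le> exp (- (real (3 ^ j) * 4))" by (simp add: w_def)
        also have "\<dots> = inverse (exp 4 ^ 3 ^ j)" by (simp only: exp_minus exp_of_nat_mult)
        also have "\<dots> \<le> inverse (16 ^ 3 ^ j)"
        proof (intro le_imp_inverse_le power_mono)
          have "(2::real) ^ 4 \<le> exp 1 ^ 4" using exp_ge_add_one_self[of 1] by (intro power_mono) auto
          also have "\<dots> = exp (4 * 1)" using exp_of_nat_mult[of 4 "1::real"] by simp
          finally show "(16::real) \<le> exp 4" by simp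
        qed auto
        finally have wl: "w l \<le> 1 / 16 ^ 3 ^ j" by (simp add: inverse_eq_divide)
        have "cmod (a n) \<le> B * exp (- c l)" using bd n by (auto simp: l_def)
        also have "exp (- c l) = w l * w l" by (simp add: w_def exp_add[symmetric])
        also have "B * (w l * w l) \<le> B * (1 / 16 ^ 3 ^ j * w l)"
          using wl B by (intro mult_left_mono mult_right_mono) (auto simp: w_def)
        finally show "cmod (a n) \<le> B / 16 ^ 3 ^ j * w (nat \<bar>n\<bar>)" by (simp add: l_def)
      qed
      also have "\<dots> \<le> (\<Sum>n = - int m..int m. B / 16 ^ 3 ^ j * w (nat \<bar>n\<bar>))"
        using B by (intro sum_mono2) (auto simp: w_def)
      also have "\<dots> = B / 16 ^ 3 ^ j * (\<Sum>n = - int m..int m. w (nat \<bar>n\<bar>))"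
        by (simp add: sum_distrib_left)
      also have "\<dots> \<le> B / 16 ^ 3 ^ j * W" using B by (intro mult_left_mono sumw) auto
      finally show ?thesis by (simp add: A_def)
    qed
    \<comment> \<open>The enlargement on each side accumulated from scale K down to scale j. As the
      sum of h over {J<..K} exceeds 8 pi, the interval at scale J covers a full period.\<close>
    define s where "s = (\<lambda>j. sum h {j<..K} / 4)"
    have s0: "s j \<ge> 0" for j unfolding s_def using h0 by (intro divide_nonneg_nonneg sum_nonneg) (auto simp: less_imp_le)
    have "\<forall>t \<in> {\<alpha> - s J..\<beta> + s J}. cmod (trig a m (of_real t)) \<le> A / 2 / 16 ^ 3 ^ J"
      using JK
    proof (induction rule: inc_induct)
      case base
      then show ?case using small by (simp add: s_def)
    next
      case (step j)
      have "{j<..K} = insert (Suc j) {Suc j<..K}" using step.hyps by auto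
      then have sj: "s j = s (Suc j) + h (Suc j) / 4" by (simp add: s_def add_divide_distrib)
      show ?case
      proof
        fix t assume t: "t \<in> {\<alpha> - s j..\<beta> + s j}"
        have "cmod (trig a m (of_real t)) \<le> 3 / 2 * A / 4 ^ 3 ^ Suc j"
        proof (rule small_on_interval_extend[OF total tail[of "Suc j"]])
          show "0 < h (Suc j)" "4 * h (Suc j) * real (N (Suc j)) \<le> real (3 ^ Suc j)"
            by (rule h0, rule hN)
          show "2 * h (Suc j) \<le> (\<beta> + s (Suc j)) - (\<alpha> - s (Suc j))"
            using hab[of "Suc j"] s0[of "Suc j"] by linarith
          show "t \<in> {\<alpha> - s (Suc j) - h (Suc j) / 4..\<beta> + s (Suc j) + h (Suc j) / 4}"
            using t by (simp add: sj algebra_simps)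
        qed (use step.IH in blast)
        \<comment> \<open>This is why the exponents triple: an extension weakens base 16 to base 4,
          but 4^3 = 4 * 16 restores base 16 at the next coarser scale and leaves a surplus 4^3^j
          that absorbs the factor 3. Doubling the exponents would leave no surplus.\<close>
        also have "(4::real) ^ 3 ^ Suc j = 4 ^ 3 ^ j * 16 ^ 3 ^ j"
        proof -
          have "(4::real) ^ 3 ^ Suc j = (4 ^ 3) ^ 3 ^ j" by (simp only: power_Suc power_mult)
          also have "\<dots> = (4 * 16) ^ 3 ^ j" by simp
          finally show ?thesis by (simp only: power_mult_distrib)
        qed
        also have "3 / 2 * A / (4 ^ 3 ^ j * 16 ^ 3 ^ j) \<le> A / 2 / 16 ^ 3 ^ j"
        proof -
          have "(4::real) ^ 1 \<le> 4 ^ 3 ^ j" by (intro power_increasing) auto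
          then have "3 / 2 * A \<le> A / 2 * 4 ^ 3 ^ j" using A by simp
          then have "3 / 2 * A / 4 ^ 3 ^ j \<le> A / 2" by (simp add: divide_le_eq)
          then have "3 / 2 * A / 4 ^ 3 ^ j / 16 ^ 3 ^ j \<le> A / 2 / 16 ^ 3 ^ j"
            by (rule divide_right_mono) simp
          then show ?thesis by simp
        qed
        finally show "cmod (trig a m (of_real t)) \<le> A / 2 / 16 ^ 3 ^ j" .
      qed
    qed
    moreover have "s J \<ge> 2 * pi" using KJ by (simp add: s_def)
    ultimately have "cmod (trig a m (of_real t)) \<le> A / 2 / 16 ^ 3 ^ J"
      using t ab s0[of J] by auto
    also have "\<dots> \<le> A / 16 ^ 3 ^ J" using A by (intro divide_right_mono) auto
    finally show "cmod (trig a m (of_real t)) \<le> \<eta>" using J\<eta> by linarith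
  qed
qed

section \<open>The de la Vallee Poussin kernel\<close>

lemma trig_coeff_le:
  assumes small: "\<forall>t \<in> {x..x + 2 * pi}. cmod (trig a m (of_real t)) \<le> \<eta>"
    and n: "n \<in> {- int m..int m}"
  shows "cmod (a n) \<le> \<eta>"
proof -
  have orth: "((\<lambda>t. exp (\<i> * of_int k * of_real t)) has_integral (if k = 0 then 2 * of_real pi else 0)) {x..x + 2 * pi}"
    for k :: int
  proof (cases "k = 0")
    case True
    show ?thesis using has_integral_const_real[of "1::complex" x "x + 2 * pi"] True
      by (simp add: scaleR_conv_of_real)
  next
    case False
    define F where "F = (\<lambda>t. exp (\<i> * of_int k * of_real t) / (\<i> * of_int k))"
    have "((\<lambda>t. exp (\<i> * of_int k * of_real t)) has_integral (F (x + 2 * pi) - F x)) {x..x + 2 * pi}"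
    proof (rule fundamental_theorem_of_calculus)
      fix t assume "t \<in> {x..x + 2 * pi}"
      have "((\<lambda>z. exp (\<i> * of_int k * z) / (\<i> * of_int k)) has_field_derivative exp (\<i> * of_int k * of_real t))
        (at (of_real t))"
        using False by (auto intro!: derivative_eq_intros)
      then show "(F has_vector_derivative exp (\<i> * of_int k * of_real t)) (at t within {x..x + 2 * pi})"
        unfolding F_def by (rule has_vector_derivative_real_field[THEN has_vector_derivative_at_within])
    qed simp
    moreover have "F (x + 2 * pi) = F x"
    proof -
      have "exp (\<i> * of_int k * of_real (x + 2 * pi)) = exp (\<i> * of_int k * of_real x) * exp (2 * of_int k * of_real pi * \<i>)"
        by (simp add: exp_add[symmetric] algebra_simps)
      also have "exp (2 * of_int k * of_real pi * \<i>) = (1::complex)"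
        using exp_integer_2pi[of "of_int k"] by simp
      finally show ?thesis by (simp add: F_def)
    qed
    ultimately show ?thesis using False by simp
  qed
  have "((\<lambda>t. \<Sum>k = - int m..int m. a k * exp (\<i> * of_int (k - n) * of_real t)) has_integral
      (\<Sum>k = - int m..int m. a k * (if k - n = 0 then 2 * of_real pi else 0))) {x..x + 2 * pi}"
    by (intro has_integral_sum has_integral_mult_right orth) auto
  also have "(\<Sum>k = - int m..int m. a k * (if k - n = 0 then 2 * of_real pi else 0)) = 2 * of_real pi * a n"
    using n by (simp add: if_distrib cong: if_cong)
  also have "(\<lambda>t. \<Sum>k = - int m..int m. a k * exp (\<i> * of_int (k - n) * of_real t))
      = (\<lambda>t. trig a m (of_real t) * exp (- (\<i> * of_int n * of_real t)))"
    unfolding trig_def sum_distrib_right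
    by (intro ext sum.cong refl) (simp add: exp_diff exp_minus divide_inverse algebra_simps)
  finally have "((\<lambda>t. trig a m (of_real t) * exp (- (\<i> * of_int n * of_real t))) has_integral 2 * of_real pi * a n)
      (cbox x (x + 2 * pi))" by simp
  then have "cmod (2 * of_real pi * a n) \<le> \<eta> * measure lborel (cbox x (x + 2 * pi))"
  proof (rule has_integral_bound[rotated])
    show "0 \<le> \<eta>" using small[rule_format, of x] by (simp add: order_trans[OF norm_ge_zero])
  qed (use small in \<open>simp add: norm_mult\<close>)
  then show ?thesis by (simp add: norm_mult)
qed

text \<open>Fourier coefficients of ((1 + cos x) / 2)^M, scaled to the value 1 at n = 0. For n < - M
  the truncation in \<open>nat\<close> gives a nonzero value, so every kernel sum is restricted to -
  M..M.\<close>

definition vallee_poussin_coeff :: "nat \<Rightarrow> int \<Rightarrow> real" where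
  "vallee_poussin_coeff M n = real ((2 * M) choose nat (int M + n)) / real ((2 * M) choose M)"

lemma vallee_poussin_coeff_bounds: "0 \<le> vallee_poussin_coeff M n" "vallee_poussin_coeff M n \<le> 1"
  using binomial_maximum'[of M "nat (int M + n)"] by (auto simp: vallee_poussin_coeff_def divide_le_eq)

text \<open>The quotient of the coefficients at k + 1 and k is (M - k) / (M + k + 1), which tends to
  1; induction on k, then the symmetry of binomial coefficients for negative n.\<close>

lemma vallee_poussin_coeff_tendsto: "(\<lambda>M. vallee_poussin_coeff M n) \<longlonglongrightarrow> 1"
proof -
  have nonneg: "(\<lambda>M. vallee_poussin_coeff M (int k)) \<longlonglongrightarrow> 1" for k
  proof (induction k)
    case 0
    show ?case by (simp add: vallee_poussin_coeff_def)
  next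
    case (Suc k)
    have "(\<lambda>M. vallee_poussin_coeff M (int k) * ((real M - real k) / (real M + real k + 1))) \<longlonglongrightarrow> 1 * 1"
      by (intro tendsto_mult Suc.IH) real_asymp
    moreover have "eventually (\<lambda>M. vallee_poussin_coeff M (int k) * ((real M - real k) / (real M + real k + 1))
        = vallee_poussin_coeff M (int (Suc k))) sequentially"
      using eventually_ge_at_top[of k]
    proof eventually_elim
      case (elim M)
      have "Suc (M + k) * (2 * M choose Suc (M + k)) = (2 * M choose (M + k)) * (M - k)"
        using binomial_absorb_comp[of "2 * M" "M + k"] binomial_absorption[of "M + k" "2 * M"] elim
        by (simp add: mult.commute)
      then have "real (Suc (M + k)) * real (2 * M choose Suc (M + k)) = real (2 * M choose (M + k)) * real (M - k)"
        by (metis of_nat_mult)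
      then have eq: "real (2 * M choose (M + k)) * (real M - real k) / (real M + real k + 1) = real (2 * M choose Suc (M + k))"
        using elim by (simp add: field_simps of_nat_diff)
      have "nat (int M + int (Suc k)) = Suc (M + k)" "nat (int M + int k) = M + k" by auto
      then show ?case unfolding vallee_poussin_coeff_def by (simp only: eq[symmetric]) simp
    qed
    ultimately show ?case by (simp add: tendsto_cong)
  qed
  show ?thesis
  proof (cases "n \<ge> 0")
    case True
    then show ?thesis using nonneg[of "nat n"] by simp
  next
    case False
    have "eventually (\<lambda>M. vallee_poussin_coeff M (int (nat (- n))) = vallee_poussin_coeff M n) sequentially"
      using eventually_ge_at_top[of "nat (- n)"]
    proof eventually_elim
      case (elim M)
      have "2 * M choose nat (int M + n) = 2 * M choose (2 * M - nat (int M + n))"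
        using False elim by (intro binomial_symmetric) auto
      also have "2 * M - nat (int M + n) = nat (int M + int (nat (- n)))" using False elim by auto
      finally show ?case by (simp add: vallee_poussin_coeff_def)
    qed
    then show ?thesis using nonneg[of "nat (- n)"] by (simp add: tendsto_cong)
  qed
qed

lemma one_plus_cos_nonneg: "0 \<le> 1 + cos (x::real)"
proof -
  have "- 1 \<le> y \<Longrightarrow> 0 \<le> 1 + y" for y :: real by linarith
  then show ?thesis using cos_ge_minus_one by blast
qed

text \<open>By the binomial theorem the sum is exp (- i M x) (1 + exp (i x))^(2 M) over the central
  binomial coefficient. The squared modulus of 1 + exp (i x) is 2 (1 + cos x), and the denominator
  is at least 4^M / (2 M).\<close>

lemma vallee_poussin_kernel_le:
  assumes "M > 0"
  shows "cmod (\<Sum>n = - int M..int M. of_real (vallee_poussin_coeff M n) * exp (\<i> * of_int n * of_real x))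
    \<le> 2 * real M * ((1 + cos x) / 2) ^ M"
proof -
  define e where "e = exp (\<i> * of_real x)"
  have "(\<Sum>n = - int M..int M. of_nat (2 * M choose nat (int M + n)) * exp (\<i> * of_int n * of_real x))
      = (\<Sum>k\<le>2 * M. of_nat (2 * M choose k) * exp (\<i> * of_int (int k - int M) * of_real x))"
    by (rule sum.reindex_bij_witness[of _ "\<lambda>k. int k - int M" "\<lambda>n. nat (int M + n)"]) auto
  also have "\<dots> = exp (- (\<i> * of_nat M * of_real x)) * (\<Sum>k\<le>2 * M. of_nat (2 * M choose k) * e ^ k)"
    unfolding sum_distrib_left
    by (intro sum.cong refl) (simp add: e_def exp_of_nat_mult[symmetric] exp_diff exp_minus field_simps)
  also have "(\<Sum>k\<le>2 * M. of_nat (2 * M choose k) * e ^ k) = (e + 1) ^ (2 * M)"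
    by (simp add: binomial_ring)
  finally have "cmod (\<Sum>n = - int M..int M. of_nat (2 * M choose nat (int M + n)) * exp (\<i> * of_int n * of_real x))
      = cmod (e + 1) ^ (2 * M)" by (simp add: norm_mult norm_power)
  also have "\<dots> = (2 * (1 + cos x)) ^ M"
  proof -
    have "(cmod (e + 1))\<^sup>2 = (cos x + 1)\<^sup>2 + (sin x)\<^sup>2"
      by (simp add: e_def cmod_power2 Re_exp Im_exp)
    also have "\<dots> = 2 * (1 + cos x)"
      using sin_cos_squared_add[of x] by (simp add: power2_eq_square algebra_simps)
    finally show ?thesis by (simp add: power_mult)
  qed
  finally have eq: "cmod (\<Sum>n = - int M..int M. of_nat (2 * M choose nat (int M + n)) * exp (\<i> * of_int n * of_real x))
      = (2 * (1 + cos x)) ^ M" .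
  have "(\<Sum>n = - int M..int M. of_real (vallee_poussin_coeff M n) * exp (\<i> * of_int n * of_real x))
      = (\<Sum>n = - int M..int M. of_nat (2 * M choose nat (int M + n)) * exp (\<i> * of_int n * of_real x))
        / of_nat (2 * M choose M)"
    by (simp add: vallee_poussin_coeff_def sum_divide_distrib)
  then have "cmod (\<Sum>n = - int M..int M. of_real (vallee_poussin_coeff M n) * exp (\<i> * of_int n * of_real x))
      = (2 * (1 + cos x)) ^ M / real (2 * M choose M)"
    using eq by (simp add: norm_divide)
  also have "\<dots> \<le> (2 * (1 + cos x)) ^ M / (4 ^ M / real (2 * M))"
  proof (rule divide_left_mono)
    show "0 \<le> (2 * (1 + cos x)) ^ M" by (intro zero_le_power mult_nonneg_nonneg one_plus_cos_nonneg) auto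
  qed (use central_binomial_lower_bound[OF assms] assms in \<open>auto intro!: mult_pos_pos divide_pos_pos\<close>)
  also have "\<dots> = 2 * real M * ((2 * (1 + cos x)) ^ M / 4 ^ M)" by simp
  also have "(2 * (1 + cos x)) ^ M / 4 ^ M = ((1 + cos x) / 2) ^ M"
  proof -
    have "2 * (1 + cos x) / 4 = (1 + cos x) / 2" by (simp add: field_simps)
    then show ?thesis by (metis power_divide)
  qed
  finally show ?thesis .
qed

lemma vallee_poussin_kernel_tendsto:
  assumes "0 < \<delta>" "\<delta> < pi" "0 < \<tau>"
  shows "eventually (\<lambda>M. \<forall>x \<in> {\<delta>..2 * pi - \<delta>}.
    cmod (\<Sum>n = - int M..int M. of_real (vallee_poussin_coeff M n) * exp (\<i> * of_int n * of_real x)) \<le> \<tau>) sequentially"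
proof -
  define q where "q = (1 + cos \<delta>) / 2"
  have "cos \<delta> < 1" using assms cos_monotone_0_pi[of 0 \<delta>] by simp
  then have q: "0 \<le> q" "q < 1" using one_plus_cos_nonneg[of \<delta>] by (auto simp: q_def)
  have "(\<lambda>M. real M * q ^ M) \<longlonglongrightarrow> 0" using q by (intro powser_times_n_limit_0) auto
  then have "eventually (\<lambda>M. real M * q ^ M < \<tau> / 2) sequentially"
    by (rule order_tendstoD) (use assms in simp)
  then show ?thesis using eventually_gt_at_top[of 0]
  proof eventually_elim
    case (elim M)
    show ?case
    proof
      fix x assume x: "x \<in> {\<delta>..2 * pi - \<delta>}"
      have "cos x \<le> cos \<delta>"
      proof (cases "x \<le> pi")
        case True
        then show ?thesis using x assms by (intro cos_monotone_0_pi_le) auto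
      next
        case False
        have "cos (2 * pi - x) \<le> cos \<delta>" using False x assms by (intro cos_monotone_0_pi_le) auto
        then show ?thesis by simp
      qed
      then have "((1 + cos x) / 2) ^ M \<le> q ^ M"
        using one_plus_cos_nonneg[of x] by (intro power_mono) (auto simp: q_def)
      then have "2 * real M * ((1 + cos x) / 2) ^ M \<le> 2 * real M * q ^ M" by (intro mult_left_mono) auto
      also have "\<dots> \<le> \<tau>" using elim by simp
      finally show "cmod (\<Sum>n = - int M..int M. of_real (vallee_poussin_coeff M n) * exp (\<i> * of_int n * of_real x)) \<le> \<tau>"
        using vallee_poussin_kernel_le[OF elim(2), of x] by linarith
    qed
  qed
qed

section \<open>Approximation on a proper arc\<close>

lemma continuous_on_trig: "continuous_on S (\<lambda>t. trig a m (of_real t))"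
  unfolding trig_def by (intro continuous_intros)

lemma trig_extend:
  assumes "\<And>n. int m < \<bar>n\<bar> \<Longrightarrow> a n = 0" "m \<le> m'"
  shows "trig a m' z = trig a m z"
  unfolding trig_def
  by (rule sum.mono_neutral_right) (use assms in \<open>auto simp: not_le abs_less_iff\<close>)

lemma integral_Re: "f integrable_on A \<Longrightarrow> integral A (\<lambda>x. Re (f x)) = Re (integral A f)"
  using integral_linear[OF _ bounded_linear_Re] by (simp add: o_def)

lemma integral_power2_nonneg: "0 \<le> integral A (\<lambda>t. (cmod (u t))\<^sup>2)"
  by (cases "(\<lambda>t. (cmod (u t))\<^sup>2) integrable_on A") (auto intro: integral_nonneg simp: not_integrable_integral)

lemma norm_power2_diff_scaleR:
  fixes u v :: complex and s :: real
  shows "(cmod (u - of_real s * v))\<^sup>2 = (cmod u)\<^sup>2 - 2 * s * Re (u * cnj v) + s\<^sup>2 * (cmod v)\<^sup>2"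
  unfolding cmod_power2 by (simp add: power2_eq_square algebra_simps)

lemma norm_power2_diff_le: "(cmod (u - v))\<^sup>2 \<le> 2 * (cmod u)\<^sup>2 + 2 * (cmod v)\<^sup>2"
proof -
  have "(cmod (u - v))\<^sup>2 \<le> (cmod u + cmod v)\<^sup>2"
    by (intro power_mono norm_triangle_ineq4) auto
  also have "\<dots> \<le> 2 * (cmod u)\<^sup>2 + 2 * (cmod v)\<^sup>2"
    using zero_le_power2[of "cmod u - cmod v"] by (simp add: power2_eq_square algebra_simps)
  finally show ?thesis .
qed

text \<open>Integrated, this and \<open>norm_le_power2\<close> take the place of the Cauchy-Schwarz
  inequality; the loss in the constants is harmless.\<close>

lemma Re_mult_cnj_le: "Re (u * cnj v) \<le> ((cmod u)\<^sup>2 + (cmod v)\<^sup>2) / 2"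
proof -
  have "Re (u * cnj v) \<le> cmod u * cmod v" using complex_Re_le_cmod[of "u * cnj v"] by (simp add: norm_mult)
  also have "\<dots> \<le> ((cmod u)\<^sup>2 + (cmod v)\<^sup>2) / 2"
    using zero_le_power2[of "cmod u - cmod v"] by (simp add: power2_eq_square algebra_simps)
  finally show ?thesis .
qed

lemma norm_le_power2: "cmod u \<le> ((cmod u)\<^sup>2 + 1) / 2"
  using zero_le_power2[of "cmod u - 1"] by (simp add: power2_eq_square algebra_simps)

text \<open>
  Working with near-minimisers avoids any compactness argument; the price is that the variational
  inequality only holds on the part of \<open>D\<close> at bounded distance from \<open>f\<close>.\<close>

lemma near_minimiser:
  fixes f :: "real \<Rightarrow> complex" and b g :: real
  defines "Q \<equiv> \<lambda>u :: real \<Rightarrow> complex. integral {b..g} (\<lambda>t. (cmod (u t))\<^sup>2)"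
  assumes D0: "D \<noteq> {}"
    and Dcont: "\<And>u. u \<in> D \<Longrightarrow> continuous_on {b..g} u"
    and Dconv: "\<And>u v s. \<lbrakk>u \<in> D; v \<in> D; 0 \<le> s; s \<le> 1\<rbrakk> \<Longrightarrow> (\<lambda>t. u t + of_real s * (v t - u t)) \<in> D"
    and f: "continuous_on {b..g} f" and \<epsilon>: "\<epsilon> > 0"
  obtains u where "u \<in> D" "Q (\<lambda>t. f t - u t) \<le> (INF u\<in>D. Q (\<lambda>t. f t - u t)) + \<epsilon>"
    "\<And>v. v \<in> D \<Longrightarrow> Q (\<lambda>t. f t - v t) \<le> G \<Longrightarrow>
      Re (integral {b..g} (\<lambda>t. (f t - u t) * cnj (v t - u t))) \<le> \<epsilon>"
proof -
  define d where "d = (INF u\<in>D. Q (\<lambda>t. f t - u t))"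
  have Q0: "0 \<le> Q u" for u unfolding Q_def by (rule integral_power2_nonneg)
  have bdd: "bdd_below ((\<lambda>u. Q (\<lambda>t. f t - u t)) ` D)" using Q0 by (auto intro!: bdd_belowI[of _ 0])
  have d0: "d \<ge> 0" unfolding d_def using Q0 D0 by (intro cINF_greatest) auto
  define Y where "Y = 2 * \<bar>G\<bar> + 2 * (d + \<epsilon>)"
  have Y: "Y > 0" using d0 \<epsilon> by (simp add: Y_def add_nonneg_pos)
  \<comment> \<open>\<open>s\<close> is the length of the step from u towards v, with s times the
    bound \<open>Y\<close> on the squared distance at most \<epsilon>. The minimiser is taken good
    up to s * \<epsilon>, because the comparison of u with u + s (v - u) is divided by s.\<close>
  define s where "s = min 1 (\<epsilon> / Y)"
  have s: "0 < s" "s \<le> 1" "s * Y \<le> \<epsilon>" using Y \<epsilon> by (auto simp: s_def min_def field_simps)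
  obtain u where u: "u \<in> D" "Q (\<lambda>t. f t - u t) < d + s * \<epsilon>"
    using cINF_less_iff[OF D0 bdd, of "d + s * \<epsilon>"] s \<epsilon> by (auto simp: d_def)
  have "s * \<epsilon> \<le> \<epsilon>" using s \<epsilon> by simp
  then have Qu: "Q (\<lambda>t. f t - u t) \<le> d + \<epsilon>" using u by linarith
  show ?thesis
  proof (rule that[OF u(1)])
    show "Q (\<lambda>t. f t - u t) \<le> (INF u\<in>D. Q (\<lambda>t. f t - u t)) + \<epsilon>" using Qu by (simp add: d_def)
    fix v assume v: "v \<in> D" "Q (\<lambda>t. f t - v t) \<le> G"
    note cont = f Dcont[OF u(1)] Dcont[OF v(1)]
    define ip where "ip = Re (integral {b..g} (\<lambda>t. (f t - u t) * cnj (v t - u t)))"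
    have ip: "ip = integral {b..g} (\<lambda>t. Re ((f t - u t) * cnj (v t - u t)))"
      unfolding ip_def by (rule integral_Re[symmetric]) (intro integrable_continuous_real continuous_intros cont)
    have "Q (\<lambda>t. v t - u t) \<le> integral {b..g} (\<lambda>t. 2 * (cmod (f t - u t))\<^sup>2 + 2 * (cmod (f t - v t))\<^sup>2)"
      unfolding Q_def
    proof (rule integral_le)
      fix t show "(cmod (v t - u t))\<^sup>2 \<le> 2 * (cmod (f t - u t))\<^sup>2 + 2 * (cmod (f t - v t))\<^sup>2"
        using norm_power2_diff_le[of "f t - u t" "f t - v t"] by simp
    qed (intro integrable_continuous_real continuous_intros cont)+
    also have "\<dots> = 2 * Q (\<lambda>t. f t - u t) + 2 * Q (\<lambda>t. f t - v t)"
      unfolding Q_def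
      by (subst integral_add) (auto intro!: integrable_continuous_real continuous_intros cont)
    also have "\<dots> \<le> Y" using Qu v by (auto simp: Y_def)
    finally have QY: "Q (\<lambda>t. v t - u t) \<le> Y" .
    have "d \<le> Q (\<lambda>t. f t - (u t + of_real s * (v t - u t)))"
      unfolding d_def using s by (intro cINF_lower bdd Dconv u v) auto
    also have "\<dots> = integral {b..g} (\<lambda>t. (cmod (f t - u t))\<^sup>2 - 2 * s * Re ((f t - u t) * cnj (v t - u t))
        + s\<^sup>2 * (cmod (v t - u t))\<^sup>2)"
      unfolding Q_def norm_power2_diff_scaleR[symmetric] by (simp add: algebra_simps)
    also have "\<dots> = Q (\<lambda>t. f t - u t) - 2 * s * ip + s\<^sup>2 * Q (\<lambda>t. v t - u t)"
      unfolding Q_def ip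
      by (subst integral_add, (intro integrable_continuous_real continuous_intros cont)+,
          subst integral_diff, (intro integrable_continuous_real continuous_intros cont)+) simp
    also have "\<dots> \<le> d + s * \<epsilon> - 2 * s * ip + s\<^sup>2 * Y"
      using u(2) mult_left_mono[OF QY, of "s\<^sup>2"] by simp
    finally have "s * (2 * ip) \<le> s * (\<epsilon> + s * Y)" by (simp add: power2_eq_square algebra_simps)
    then have "2 * ip \<le> \<epsilon> + s * Y" using s by simp
    then show "ip \<le> \<epsilon>" using s by linarith
  qed
qed

text \<open>The cut-off N lets a block be added without touching earlier coefficients, and the bound
  m makes \<open>trig a m\<close> the whole polynomial. For fixed m these sequences form a convex
  set.\<close>

definition admissible :: "(nat \<Rightarrow> real) \<Rightarrow> nat \<Rightarrow> nat \<Rightarrow> (int \<Rightarrow> complex) set" where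
  "admissible c N m = {a. (\<forall>n. cmod (a n) \<le> exp (c (nat \<bar>n\<bar>)))
    \<and> (\<forall>n. a n \<noteq> 0 \<longrightarrow> int N < \<bar>n\<bar> \<and> \<bar>n\<bar> \<le> int m)}"

lemma admissible_mono: "a \<in> admissible c N m \<Longrightarrow> m \<le> m' \<Longrightarrow> a \<in> admissible c N m'"
  by (fastforce simp: admissible_def)

lemma trig_admissible_extend: "a \<in> admissible c N m \<Longrightarrow> m \<le> m' \<Longrightarrow> trig a m' z = trig a m z"
  by (rule trig_extend) (fastforce simp: admissible_def)+

text \<open>
  Duality in Hilbert space form: a near-minimiser leaves a residual \<open>r\<close> on the arc whose Fourier
  coefficients \<open>\<mu> n\<close> are at most of order \<open>exp (- c n)\<close>. Convolved with a de la Vallee Poussin kernel, \<open>r\<close> becomes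
  a trigonometric polynomial that almost vanishes on the complementary arc, hence is small.\<close>

lemma L2_approximation:
  fixes f :: "int \<Rightarrow> complex" and b g \<epsilon> :: real
  assumes c: "c \<in> class_X_plus" and bg: "b < g" "g < b + 2 * pi" and \<epsilon>: "\<epsilon> > 0"
  obtains a m where "a \<in> admissible c N m"
    "integral {b..g} (\<lambda>t. (cmod (trig f N (of_real t) - trig a m (of_real t)))\<^sup>2) < \<epsilon>"
proof -
  have cpos: "c n > 0" for n using c by (simp add: class_X_plus_def)
  define Q where "Q = (\<lambda>u :: real \<Rightarrow> complex. integral {b..g} (\<lambda>t. (cmod (u t))\<^sup>2))"
  define E where "E = (\<lambda>a m t. trig a m (of_real t))"
  define D where "D = {E a m | a m. a \<in> admissible c N m}"
  define F where "F = E f N"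
  define d where "d = (INF u\<in>D. Q (\<lambda>t. F t - u t))"
  have contE: "continuous_on S (E a m)" for S a m unfolding E_def by (rule continuous_on_trig)
  have contF: "continuous_on S F" for S unfolding F_def by (rule contE)
  have zero: "(\<lambda>t. 0) \<in> D"
  proof -
    have "(\<lambda>t. 0) = E (\<lambda>n. 0) 0" by (auto simp: E_def trig_def)
    moreover have "(\<lambda>n. 0) \<in> admissible c N 0" by (simp add: admissible_def)
    ultimately show ?thesis unfolding D_def by blast
  qed
  have convex: "(\<lambda>t. u t + of_real s * (v t - u t)) \<in> D"
    if "u \<in> D" "v \<in> D" "0 \<le> s" "s \<le> 1" for u v s
  proof -
    obtain a m a' m' where u: "u = E a m" "a \<in> admissible c N m" and v: "v = E a' m'" "a' \<in> admissible c N m'"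
      using \<open>u \<in> D\<close> \<open>v \<in> D\<close> by (auto simp: D_def)
    define k where "k = max m m'"
    have am: "a \<in> admissible c N k" "a' \<in> admissible c N k"
      using u v by (auto simp: k_def intro: admissible_mono)
    define p where "p = (\<lambda>n. a n + of_real s * (a' n - a n))"
    have uk: "u = E a k" using trig_admissible_extend[OF u(2), of k] u(1) by (simp add: E_def k_def)
    have vk: "v = E a' k" using trig_admissible_extend[OF v(2), of k] v(1) by (simp add: E_def k_def)
    have "cmod (p n) \<le> exp (c (nat \<bar>n\<bar>))" for n
    proof -
      have "p n = of_real (1 - s) * a n + of_real s * a' n" by (simp add: p_def algebra_simps)
      then have "cmod (p n) \<le> (1 - s) * cmod (a n) + s * cmod (a' n)"
        using norm_triangle_ineq[of "of_real (1 - s) * a n" "of_real s * a' n"] that by (simp only: norm_mult norm_of_real)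
      also have "\<dots> \<le> (1 - s) * exp (c (nat \<bar>n\<bar>)) + s * exp (c (nat \<bar>n\<bar>))"
        using am that by (intro add_mono mult_left_mono) (auto simp: admissible_def)
      finally show ?thesis by (simp add: algebra_simps)
    qed
    moreover have "int N < \<bar>n\<bar> \<and> \<bar>n\<bar> \<le> int k" if "p n \<noteq> 0" for n
      using am that by (cases "a n = 0") (auto simp: admissible_def p_def)
    ultimately have "p \<in> admissible c N k" by (simp add: admissible_def)
    moreover have "(\<lambda>t. u t + of_real s * (v t - u t)) = E p k"
      unfolding uk vk by (auto simp: E_def trig_def p_def sum.distrib[symmetric] sum_subtractf[symmetric]
          sum_distrib_left algebra_simps)
    ultimately show ?thesis unfolding D_def by blast
  qed
  have Dcont: "continuous_on {b..g} u" if "u \<in> D" for u using that contE by (auto simp: D_def)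
  have Q0: "0 \<le> Q u" for u unfolding Q_def by (rule integral_power2_nonneg)
  have bdd: "bdd_below ((\<lambda>u. Q (\<lambda>t. F t - u t)) ` D)" using Q0 by (auto intro!: bdd_belowI[of _ 0])
  define E0 where "E0 = Q F"
  have dE0: "d \<le> E0" using cINF_lower[OF bdd zero] by (simp add: d_def E0_def)
  have E0: "E0 \<ge> 0" using Q0 by (simp add: E0_def)
  \<comment> \<open>The order of choices is essential: \<tau> and M come from bounds not involving
    u, M then fixes the distance \<open>G\<close> up to which u is tested, and only then is u
    chosen. This is possible since Q r \<le> E0 + 1 holds for every such u.\<close>
  have key: "d \<le> 2 * \<epsilon>" if \<epsilon>: "0 < \<epsilon>" "\<epsilon> \<le> 1" for \<epsilon>
  proof -
    define L where "L = g - b"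
    have L: "L > 0" using bg by (simp add: L_def)
    \<comment> \<open>Residual coefficients beyond N are at most (E0 + 2) exp (- c) by duality;
      those up to N are merely bounded by the L1 norm. The sum of exponentials compensates exp (- c)
      for the latter.\<close>
    define B where "B = (E0 + 2 + L) * (\<Sum>n\<le>N. exp (c n))"
    have eB: "exp (c n) \<le> (\<Sum>n\<le>N. exp (c n))" if "n \<le> N" for n
      using that by (intro member_le_sum) auto
    have "1 \<le> (\<Sum>n\<le>N. exp (c n))" using eB[of 0] cpos[of 0] one_le_exp_iff[of "c 0"] by linarith
    then have B2: "E0 + 2 + L \<le> B" unfolding B_def using E0 L by simp
    then have B: "B > 0" using E0 L by linarith
    define \<eta> where "\<eta> = \<epsilon> / (2 * ((\<Sum>n = - int N..int N. cmod (f n)) + 1))"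
    define \<phi> where "\<phi> = (\<Sum>n = - int N..int N. cmod (f n))"
    have \<phi>: "\<phi> \<ge> 0" unfolding \<phi>_def by (intro sum_nonneg) auto
    have \<eta>: "\<eta> > 0" using \<epsilon> \<phi> by (simp add: \<eta>_def \<phi>_def[symmetric])
    have \<eta>\<phi>: "2 * \<eta> * \<phi> \<le> \<epsilon>" using \<epsilon> \<phi> unfolding \<eta>_def \<phi>_def[symmetric] by (simp add: field_simps)
    \<comment> \<open>The gap from g - 2 pi to b has length 3 \<delta>, and {\<alpha>..\<alpha> +
      \<delta>} is its middle third. Differences between points of {b..g} and of this third lie in
      {\<delta>..2 pi - \<delta>}, where the kernel is small.\<close>
    define \<delta> where "\<delta> = (b - g + 2 * pi) / 3"
    have \<delta>: "0 < \<delta>" "\<delta> < pi" using bg by (auto simp: \<delta>_def)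
    define \<alpha> where "\<alpha> = b - 2 * \<delta>"
    have \<alpha>: "\<alpha> < \<alpha> + \<delta>" using \<delta> by simp
    obtain \<tau> where \<tau>: "\<tau> > 0" and uniq: "\<And>a m t. \<lbrakk>\<forall>n \<in> {- int m..int m}. cmod (a n) \<le> B * exp (- c (nat \<bar>n\<bar>));
        \<forall>t \<in> {\<alpha>..\<alpha> + \<delta>}. cmod (trig a m (of_real t)) \<le> \<tau>; t \<in> {\<alpha>..\<alpha> + 2 * pi}\<rbrakk>
      \<Longrightarrow> cmod (trig a m (of_real t)) \<le> \<eta>"
      using small_on_arc_imp_small[OF c \<alpha> B \<eta>] by metis
    define \<tau>' where "\<tau>' = \<tau> / (E0 + 1 + L)"
    have \<tau>': "\<tau>' > 0" using \<tau> E0 L by (simp add: \<tau>'_def)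
    have "eventually (\<lambda>M. \<forall>n \<in> {- int N..int N}. vallee_poussin_coeff M n > 1 / 2) sequentially"
    proof (rule eventually_ball_finite, simp, rule ballI)
      fix n show "eventually (\<lambda>M. vallee_poussin_coeff M n > 1 / 2) sequentially"
        using vallee_poussin_coeff_tendsto by (rule order_tendstoD) simp
    qed
    moreover note vallee_poussin_kernel_tendsto[OF \<delta> \<tau>']
    moreover note eventually_ge_at_top[of N]
    ultimately have ev: "eventually (\<lambda>M. (\<forall>n \<in> {- int N..int N}. vallee_poussin_coeff M n > 1 / 2) \<and>
        (\<forall>x \<in> {\<delta>..2 * pi - \<delta>}. cmod (\<Sum>n = - int M..int M. of_real (vallee_poussin_coeff M n) * exp (\<i> * of_int n * of_real x)) \<le> \<tau>') \<and> N \<le> M) sequentially"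
      by eventually_elim auto
    obtain M where MK: "\<And>n. n \<in> {- int N..int N} \<Longrightarrow> vallee_poussin_coeff M n > 1 / 2"
      and Mk: "\<And>x. x \<in> {\<delta>..2 * pi - \<delta>} \<Longrightarrow> cmod (\<Sum>n = - int M..int M. of_real (vallee_poussin_coeff M n) * exp (\<i> * of_int n * of_real x)) \<le> \<tau>'"
      and MN: "N \<le> M"
      using eventually_happens'[OF sequentially_bot ev] by blast
    \<comment> \<open>A sup norm bound for a single admissible mode of frequency at most M;
      \<open>G\<close> bounds its squared distance from F. Such modes and 0 are the only competitors
      that are tested.\<close>
    define X where "X = (\<Sum>n\<le>M. exp (c n))"
    define G where "G = (\<phi> + X)\<^sup>2 * L"
    obtain u where uD: "u \<in> D" and Qu: "Q (\<lambda>t. F t - u t) \<le> d + \<epsilon>"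
      and var: "\<And>v. v \<in> D \<Longrightarrow> Q (\<lambda>t. F t - v t) \<le> G \<Longrightarrow>
        Re (integral {b..g} (\<lambda>t. (F t - u t) * cnj (v t - u t))) \<le> \<epsilon>"
    proof -
      have "D \<noteq> {}" using zero by blast
      from near_minimiser[OF this Dcont convex contF \<epsilon>(1), of G] that show thesis
        unfolding d_def Q_def by blast
    qed
    define r where "r = (\<lambda>t. F t - u t)"
    have contr: "continuous_on {b..g} r" unfolding r_def by (intro continuous_intros contF Dcont uD)
    have Qr: "Q r \<le> E0 + 1" using Qu dE0 \<epsilon> by (simp add: r_def)
    define ip where "ip = (\<lambda>v. integral {b..g} (\<lambda>t. r t * cnj (v t)))"
    have ip_diff: "ip (\<lambda>t. v t - w t) = ip v - ip w" if "continuous_on {b..g} v" "continuous_on {b..g} w" for v w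
      unfolding ip_def complex_cnj_diff right_diff_distrib
      by (rule integral_diff) (intro integrable_continuous_real continuous_intros contr that)+
    have ip_rr: "ip r = of_real (Q r)"
    proof -
      have "ip r = integral {b..g} (\<lambda>t. of_real ((cmod (r t))\<^sup>2))"
        unfolding ip_def complex_norm_square[symmetric] ..
      also have "\<dots> = of_real (Q r)" unfolding Q_def
        using integral_linear[OF _ bounded_linear_of_real, of "\<lambda>t. (cmod (r t))\<^sup>2" "{b..g}"] contr
        by (simp add: o_def integrable_continuous_real continuous_intros)
      finally show ?thesis .
    qed
    have ip_r: "ip r = ip F - ip u"
    proof -
      have "ip (\<lambda>t. F t - u t) = ip F - ip u" by (intro ip_diff contF Dcont uD)
      then show ?thesis by (simp add: r_def)
    qed
    have QG: "Q (\<lambda>t. F t - v t) \<le> G" if v: "\<And>t. cmod (v t) \<le> X" "continuous_on {b..g} v" for v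
    proof -
      have "Q (\<lambda>t. F t - v t) \<le> integral {b..g} (\<lambda>t. (\<phi> + X)\<^sup>2)"
        unfolding Q_def
      proof (rule integral_le)
        fix t
        have "cmod (F t) \<le> \<phi>" unfolding F_def E_def \<phi>_def by (rule norm_trig_le)
        then have "cmod (F t - v t) \<le> \<phi> + X" using v(1)[of t] norm_triangle_ineq4[of "F t" "v t"] by linarith
        then show "(cmod (F t - v t))\<^sup>2 \<le> (\<phi> + X)\<^sup>2" by (rule power_mono) simp
      qed (intro integrable_continuous_real continuous_intros contF v)+
      also have "\<dots> = G" using bg by (simp add: G_def L_def)
      finally show ?thesis .
    qed
    have X0: "X \<ge> 0" unfolding X_def by (intro sum_nonneg) auto
    have var': "Re (ip v) - Re (ip u) \<le> \<epsilon>" if "v \<in> D" "\<And>t. cmod (v t) \<le> X" for v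
    proof -
      have "Re (ip (\<lambda>t. v t - u t)) \<le> \<epsilon>"
        unfolding ip_def r_def by (intro var QG that Dcont)
      then show ?thesis using ip_diff[OF Dcont[OF that(1)] Dcont[OF uD]] by simp
    qed
    \<comment> \<open>Testing against 0 reduces the claim to the smallness of ip F, which involves
      only the coefficients of the residual up to N.\<close>
    have "- Re (ip u) \<le> \<epsilon>" using var'[OF zero] X0 by (simp add: ip_def)
    then have QrF: "Q r \<le> Re (ip F) + \<epsilon>" using ip_r ip_rr by (simp add: complex_eq_iff)
    have ReF: "Re (ip F) \<le> (Q r + E0) / 2"
    proof -
      have "Re (ip F) = integral {b..g} (\<lambda>t. Re (r t * cnj (F t)))"
        unfolding ip_def by (rule integral_Re[symmetric]) (intro integrable_continuous_real continuous_intros contr contF)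
      also have "\<dots> \<le> integral {b..g} (\<lambda>t. ((cmod (r t))\<^sup>2 + (cmod (F t))\<^sup>2) / 2)"
        by (intro integral_le integrable_continuous_real continuous_intros contr contF Re_mult_cnj_le) auto
      also have "\<dots> = (Q r + E0) / 2"
        unfolding Q_def E0_def
        by (simp, subst integral_add, (intro integrable_continuous_real continuous_intros contr contF)+) simp
      finally show ?thesis .
    qed
    have Reu: "Re (ip u) \<le> E0 + 1"
    proof -
      have "Re (ip u) = Re (ip F) - Q r" using ip_r ip_rr by (simp add: algebra_simps complex_eq_iff)
      then show ?thesis using ReF Q0[of r] E0 Qr by simp
    qed
    have L1: "integral {b..g} (\<lambda>t. cmod (r t)) \<le> (E0 + 1 + L) / 2"
    proof -
      have "integral {b..g} (\<lambda>t. cmod (r t)) \<le> integral {b..g} (\<lambda>t. ((cmod (r t))\<^sup>2 + 1) / 2)"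
        by (intro integral_le integrable_continuous_real continuous_intros contr norm_le_power2) auto
      also have "\<dots> = (Q r + L) / 2" unfolding Q_def L_def using bg
        by (simp, subst integral_add, (intro integrable_continuous_real continuous_intros contr)+) simp
      finally show ?thesis using Qr by simp
    qed
    define e where "e = (\<lambda>n t. exp (\<i> * of_int n * of_real t) :: complex)"
    have conte: "continuous_on S (e n)" for S n unfolding e_def by (intro continuous_intros)
    have norme: "cmod (e n t) = 1" for n t by (simp add: e_def)
    define \<mu> where "\<mu> = (\<lambda>n. ip (e n))"
    have \<mu>L1: "cmod (\<mu> n) \<le> (E0 + 1 + L) / 2" for n
    proof -
      have "cmod (\<mu> n) \<le> integral {b..g} (\<lambda>t. cmod (r t))"
        unfolding \<mu>_def ip_def
        by (intro integral_norm_bound_integral integrable_continuous_real continuous_intros contr conte)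
          (simp add: norm_mult norme)
      then show ?thesis using L1 by linarith
    qed
    have \<mu>exp: "cmod (\<mu> n) \<le> (E0 + 2) * exp (- c (nat \<bar>n\<bar>))" if n: "int N < \<bar>n\<bar>" "\<bar>n\<bar> \<le> int M" for n
    proof -
      define l where "l = nat \<bar>n\<bar>"
      \<comment> \<open>The largest amplitude allowed at frequency n, with the phase that makes the
        pairing with the residual equal to exp (c l) times the modulus of \<mu> n.\<close>
      define z where "z = of_real (exp (c l)) * sgn (\<mu> n)"
      define a where "a = (\<lambda>k. if k = n then z else 0)"
      have nz: "cmod z \<le> exp (c l)" by (simp add: z_def norm_mult norm_sgn)
      have "- int M \<le> n \<and> n \<le> int M" using n by auto
      then have "E a M = (\<lambda>t. z * e n t)"
        by (auto simp: E_def trig_def a_def e_def if_distrib[of "\<lambda>x. x * _"] cong: if_cong)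
      moreover have "a \<in> admissible c N M" using n nz by (auto simp: admissible_def a_def l_def)
      ultimately have zD: "(\<lambda>t. z * e n t) \<in> D" unfolding D_def by (metis (mono_tags, lifting) mem_Collect_eq)
      have "exp (c l) \<le> X" unfolding X_def using n by (intro member_le_sum) (auto simp: l_def)
      then have "Re (ip (\<lambda>t. z * e n t)) - Re (ip u) \<le> \<epsilon>"
        using nz by (intro var' zD) (simp add: norm_mult norme)
      moreover have "ip (\<lambda>t. z * e n t) = of_real (exp (c l) * cmod (\<mu> n))"
      proof -
        have "ip (\<lambda>t. z * e n t) = cnj z * \<mu> n"
          unfolding ip_def \<mu>_def by (simp add: mult.left_commute)
        also have "\<dots> = of_real (exp (c l)) * (cnj (sgn (\<mu> n)) * \<mu> n)" by (simp add: z_def)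
        also have "cnj (sgn (\<mu> n)) * \<mu> n = of_real (cmod (\<mu> n))"
        proof (cases "\<mu> n = 0")
          case False
          have "cnj (sgn (\<mu> n)) * \<mu> n = \<mu> n * cnj (\<mu> n) / of_real (cmod (\<mu> n))"
            by (simp add: sgn_eq)
          also have "\<dots> = of_real (cmod (\<mu> n))" using False
            by (simp add: complex_norm_square[symmetric] power2_eq_square)
          finally show ?thesis .
        qed simp
        finally show ?thesis by simp
      qed
      ultimately have "exp (c l) * cmod (\<mu> n) \<le> E0 + 2" using Reu \<epsilon> by simp
      then show ?thesis by (simp add: l_def exp_minus field_simps)
    qed
    \<comment> \<open>The coefficients, for \<bar>n\<bar> \<le> M, of the convolution of the kernel
      with r extended by zero. Multiplying by kernel coefficients cuts the frequencies off at M
      without increasing moduli, and at least half of each \<mu> n with \<bar>n\<bar> \<le> N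
      survives.\<close>
    define A where "A = (\<lambda>n. \<mu> n * of_real (vallee_poussin_coeff M n))"
    have normA: "cmod (A n) = cmod (\<mu> n) * vallee_poussin_coeff M n" for n
      using vallee_poussin_coeff_bounds(1)[of M n] by (simp add: A_def norm_mult)
    have AB: "\<forall>n \<in> {- int M..int M}. cmod (A n) \<le> B * exp (- c (nat \<bar>n\<bar>))"
    proof
      fix n assume n: "n \<in> {- int M..int M}"
      have "cmod (A n) \<le> cmod (\<mu> n)" using vallee_poussin_coeff_bounds(2)[of M n] normA by (simp add: mult_left_le)
      also have "\<dots> \<le> B * exp (- c (nat \<bar>n\<bar>))"
      proof (cases "int N < \<bar>n\<bar>")
        case True
        then have "cmod (\<mu> n) \<le> (E0 + 2) * exp (- c (nat \<bar>n\<bar>))" using n by (intro \<mu>exp) auto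
        also have "\<dots> \<le> B * exp (- c (nat \<bar>n\<bar>))" using B2 L by (intro mult_right_mono) auto
        finally show ?thesis .
      next
        case False
        then have "exp (c (nat \<bar>n\<bar>)) \<le> (\<Sum>n\<le>N. exp (c n))" by (intro eB) auto
        then have "(E0 + 2 + L) * exp (c (nat \<bar>n\<bar>)) \<le> B" unfolding B_def
          using E0 L by (intro mult_left_mono) auto
        then have "E0 + 2 + L \<le> B * exp (- c (nat \<bar>n\<bar>))" by (simp add: exp_minus field_simps)
        then show ?thesis using \<mu>L1[of n] E0 L by (simp add: field_simps)
      qed
      finally show "cmod (A n) \<le> B * exp (- c (nat \<bar>n\<bar>))" .
    qed
    have A\<tau>: "\<forall>\<theta> \<in> {\<alpha>..\<alpha> + \<delta>}. cmod (trig A M (of_real \<theta>)) \<le> \<tau>"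
    proof
      fix \<theta> assume \<theta>: "\<theta> \<in> {\<alpha>..\<alpha> + \<delta>}"
      define k where "k = (\<lambda>x. \<Sum>n = - int M..int M. of_real (vallee_poussin_coeff M n) * exp (\<i> * of_int n * of_real x) :: complex)"
      have k: "cmod (k (\<theta> - t)) \<le> \<tau>'" if "t \<in> {b..g}" for t
      proof -
        have "cnj (k (t - \<theta>)) = k (\<theta> - t)"
          unfolding k_def by (simp add: exp_cnj algebra_simps)
        then have "cmod (k (\<theta> - t)) = cmod (k (t - \<theta>))" by (metis complex_mod_cnj)
        also have "\<dots> \<le> \<tau>'" unfolding k_def
          using \<theta> that by (intro Mk) (auto simp: \<alpha>_def \<delta>_def field_simps)
        finally show ?thesis .
      qed
      have contk: "continuous_on S (\<lambda>t. k (\<theta> - t))" for S unfolding k_def by (intro continuous_intros)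
      have "trig A M (of_real \<theta>) = (\<Sum>n = - int M..int M.
          integral {b..g} (\<lambda>t. r t * cnj (e n t) * (of_real (vallee_poussin_coeff M n) * e n \<theta>)))"
        unfolding trig_def A_def \<mu>_def ip_def integral_mult_left by (simp add: e_def mult.assoc)
      also have "\<dots> = integral {b..g} (\<lambda>t. \<Sum>n = - int M..int M. r t * cnj (e n t) * (of_real (vallee_poussin_coeff M n) * e n \<theta>))"
        by (rule integral_sum[symmetric]) (auto intro!: integrable_continuous_real continuous_intros contr conte)
      also have "\<dots> = integral {b..g} (\<lambda>t. r t * k (\<theta> - t))"
        unfolding k_def sum_distrib_left
        by (intro integral_cong sum.cong refl) (simp add: e_def exp_cnj exp_diff exp_minus field_simps)
      finally have "cmod (trig A M (of_real \<theta>)) \<le> integral {b..g} (\<lambda>t. cmod (r t) * \<tau>')"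
        by (simp only:) (intro integral_norm_bound_integral integrable_continuous_real continuous_intros contr contk,
          simp add: norm_mult mult_left_mono k)
      also have "\<dots> \<le> (E0 + 1 + L) / 2 * \<tau>'" using L1 \<tau>' by simp
      also have "\<dots> \<le> \<tau>" using \<tau> E0 L by (simp add: \<tau>'_def field_simps)
      finally show "cmod (trig A M (of_real \<theta>)) \<le> \<tau>" .
    qed
    have \<mu>\<eta>: "cmod (\<mu> n) \<le> 2 * \<eta>" if n: "n \<in> {- int N..int N}" for n
    proof -
      have "cmod (A n) \<le> \<eta>"
        by (rule trig_coeff_le[of \<alpha> A M]) (use uniq[OF AB A\<tau>] n MN in auto)
      moreover have "cmod (\<mu> n) * (1 / 2) \<le> cmod (\<mu> n) * vallee_poussin_coeff M n"
        using MK[OF n] by (intro mult_left_mono) auto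
      ultimately show ?thesis using normA[of n] by simp
    qed
    have "ip F = (\<Sum>n = - int N..int N. cnj (f n) * \<mu> n)"
    proof -
      have "ip F = integral {b..g} (\<lambda>t. \<Sum>n = - int N..int N. cnj (f n) * (r t * cnj (e n t)))"
        unfolding ip_def F_def E_def trig_def e_def
        by (simp add: sum_distrib_left mult_ac)
      also have "\<dots> = (\<Sum>n = - int N..int N. integral {b..g} (\<lambda>t. cnj (f n) * (r t * cnj (e n t))))"
        by (rule integral_sum) (auto intro!: integrable_continuous_real continuous_intros contr conte)
      finally show ?thesis by (simp add: \<mu>_def ip_def)
    qed
    then have "cmod (ip F) \<le> (\<Sum>n = - int N..int N. cmod (f n) * (2 * \<eta>))"
      by (simp only:) (rule sum_norm_le, simp add: norm_mult mult_left_mono \<mu>\<eta>)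
    also have "\<dots> = 2 * \<eta> * \<phi>" by (simp add: \<phi>_def sum_distrib_left mult_ac)
    finally have "Re (ip F) \<le> \<epsilon>" using \<eta>\<phi> complex_Re_le_cmod[of "ip F"] by linarith
    moreover have "d \<le> Q r" unfolding d_def r_def by (intro cINF_lower bdd uD)
    ultimately show ?thesis using QrF by linarith
  qed
  have "d < \<epsilon>"
  proof -
    have "d \<le> 2 * min 1 (\<epsilon> / 3)" using \<epsilon> by (intro key) auto
    also have "\<dots> < \<epsilon>" using \<epsilon> by (auto simp: min_def)
    finally show ?thesis .
  qed
  then obtain u where "u \<in> D" "Q (\<lambda>t. F t - u t) < \<epsilon>"
    using cINF_less_iff[OF _ bdd, of \<epsilon>] zero by (auto simp: d_def)
  then show ?thesis using that by (auto simp: D_def Q_def F_def E_def)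
qed

text \<open>Averaging an L2 approximant over {t - \<delta>..t + \<delta>} multiplies each
  coefficient by the mean of a unimodular function, so it stays admissible, and it turns closeness
  in the mean on a slightly longer arc into uniform closeness.\<close>

lemma uniform_approximation:
  fixes f :: "int \<Rightarrow> complex" and b g \<epsilon> :: real
  assumes c: "c \<in> class_X_plus" and bg: "b < g" "g < b + 2 * pi" and \<epsilon>: "\<epsilon> > 0"
  obtains a m where "a \<in> admissible c N m"
    "\<forall>t \<in> {b..g}. cmod (trig f N (of_real t) - trig a m (of_real t)) < \<epsilon>"
proof -
  define F where "F = (\<lambda>t::real. trig f N (of_real t))"
  have contF: "continuous_on S F" for S unfolding F_def by (rule continuous_on_trig)
  have "uniformly_continuous_on {b - 1..g + 1} F" by (intro compact_uniformly_continuous contF) auto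
  moreover have "\<epsilon> / 4 > 0" using \<epsilon> by simp
  ultimately obtain \<delta>0 where \<delta>0: "\<delta>0 > 0"
    and F\<delta>: "\<And>x y. \<lbrakk>x \<in> {b - 1..g + 1}; y \<in> {b - 1..g + 1}; dist y x < \<delta>0\<rbrakk> \<Longrightarrow> dist (F y) (F x) < \<epsilon> / 4"
    unfolding uniformly_continuous_on_def by blast
  define \<delta> where "\<delta> = min (min 1 (\<delta>0 / 2)) ((b + 2 * pi - g) / 4)"
  have \<delta>: "\<delta> > 0" "\<delta> \<le> 1" "\<delta> < \<delta>0" "4 * \<delta> \<le> b + 2 * pi - g"
    using bg \<delta>0 by (auto simp: \<delta>_def min_def)
  have bg': "b - \<delta> < g + \<delta>" "g + \<delta> < b - \<delta> + 2 * pi" using bg \<delta> by linarith+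
  have \<delta>\<epsilon>: "\<delta> * \<epsilon>\<^sup>2 > 0" using \<delta> \<epsilon> by simp
  obtain a m where a: "a \<in> admissible c N m"
    and L2: "integral {b - \<delta>..g + \<delta>} (\<lambda>t. (cmod (trig f N (of_real t) - trig a m (of_real t)))\<^sup>2) < \<delta> * \<epsilon>\<^sup>2"
    by (rule L2_approximation[OF c bg' \<delta>\<epsilon>])
  define P where "P = (\<lambda>t::real. trig a m (of_real t))"
  have contP: "continuous_on S P" for S unfolding P_def by (rule continuous_on_trig)
  define e where "e = (\<lambda>n t. exp (\<i> * of_int n * of_real t) :: complex)"
  have conte: "continuous_on S (e n)" for S n unfolding e_def by (intro continuous_intros)
  define \<sigma> where "\<sigma> = (\<lambda>n. integral {- \<delta>..\<delta>} (e n) / of_real (2 * \<delta>))"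
  have \<sigma>: "cmod (\<sigma> n) \<le> 1" for n
  proof -
    have "cmod (integral {- \<delta>..\<delta>} (e n)) \<le> integral {- \<delta>..\<delta>} (\<lambda>t. 1)"
      by (intro integral_norm_bound_integral integrable_continuous_real conte continuous_intros)
        (simp add: e_def)
    then show ?thesis using \<delta> by (simp add: \<sigma>_def norm_divide divide_le_eq)
  qed
  define p where "p = (\<lambda>n. a n * \<sigma> n)"
  have padm: "p \<in> admissible c N m"
  proof -
    have "cmod (p n) \<le> exp (c (nat \<bar>n\<bar>))" for n
    proof -
      have "cmod (p n) \<le> cmod (a n)" using \<sigma>[of n] by (simp add: p_def norm_mult mult_left_le)
      also have "\<dots> \<le> exp (c (nat \<bar>n\<bar>))" using a by (simp add: admissible_def)
      finally show ?thesis .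
    qed
    then show ?thesis using a by (auto simp: admissible_def p_def)
  qed
  have avg: "of_real (2 * \<delta>) * trig p m (of_real t) = integral {t - \<delta>..t + \<delta>} P" for t
  proof -
    have shift: "integral {t - \<delta>..t + \<delta>} (e n) = e n t * (of_real (2 * \<delta>) * \<sigma> n)" for n
    proof -
      have "integral {t - \<delta>..t + \<delta>} (e n) = integral {- \<delta>..\<delta>} (e n \<circ> (\<lambda>s. s + t))"
        using integral_shift[of "- \<delta>" t \<delta> "e n"] conte by (simp add: algebra_simps)
      also have "\<dots> = integral {- \<delta>..\<delta>} (\<lambda>s. e n t * e n s)"
        by (intro integral_cong) (simp add: e_def exp_add[symmetric] algebra_simps)
      also have "\<dots> = e n t * (of_real (2 * \<delta>) * \<sigma> n)"
        using \<delta> by (simp add: \<sigma>_def)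
      finally show ?thesis .
    qed
    have "integral {t - \<delta>..t + \<delta>} P = integral {t - \<delta>..t + \<delta>} (\<lambda>u. \<Sum>n = - int m..int m. a n * e n u)"
      by (simp add: P_def trig_def e_def)
    also have "\<dots> = (\<Sum>n = - int m..int m. a n * integral {t - \<delta>..t + \<delta>} (e n))"
      by (subst integral_sum) (auto intro!: integrable_continuous_real continuous_intros conte)
    also have "\<dots> = of_real (2 * \<delta>) * trig p m (of_real t)"
      unfolding shift trig_def p_def sum_distrib_left by (intro sum.cong refl) (simp add: e_def)
    finally show ?thesis ..
  qed
  show ?thesis
  proof (rule that[OF padm], rule ballI)
    fix t assume t: "t \<in> {b..g}"
    \<comment> \<open>One \<epsilon> / 4 is the oscillation of F, the rest is x \<le> \<epsilon> / 4
      + x^2 / \<epsilon>. Integrated over length 2 \<delta> this gives \<delta> * \<epsilon> plus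
      less than another \<delta> * \<epsilon>, by the L2 tolerance \<delta> * \<epsilon>^2.\<close>
    have FP: "cmod (F t - P u) \<le> \<epsilon> / 2 + (cmod (F u - P u))\<^sup>2 / \<epsilon>" if u: "u \<in> {t - \<delta>..t + \<delta>}" for u
    proof -
      have "dist (F u) (F t) < \<epsilon> / 4" using t u \<delta> by (intro F\<delta>) (auto simp: dist_real_def)
      then have "cmod (F t - F u) \<le> \<epsilon> / 4" by (simp add: dist_norm norm_minus_commute)
      moreover have "cmod (F u - P u) \<le> \<epsilon> / 4 + (cmod (F u - P u))\<^sup>2 / \<epsilon>"
      proof -
        have "0 \<le> (cmod (F u - P u) - \<epsilon> / 2)\<^sup>2" by simp
        then show ?thesis using \<epsilon> by (simp add: power2_eq_square field_simps)
      qed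
      ultimately show ?thesis using norm_triangle_ineq[of "F t - F u" "F u - P u"] by simp
    qed
    have "of_real (2 * \<delta>) * (F t - trig p m (of_real t)) = integral {t - \<delta>..t + \<delta>} (\<lambda>u. F t - P u)"
      using avg[of t] \<delta> contP
      by (subst integral_diff) (auto intro!: integrable_continuous_real simp: right_diff_distrib scaleR_conv_of_real)
    then have "cmod (of_real (2 * \<delta>) * (F t - trig p m (of_real t))) = cmod (integral {t - \<delta>..t + \<delta>} (\<lambda>u. F t - P u))"
      by simp
    then have "2 * \<delta> * cmod (F t - trig p m (of_real t)) = cmod (integral {t - \<delta>..t + \<delta>} (\<lambda>u. F t - P u))"
      using \<delta> by (simp only: norm_mult norm_of_real abs_mult abs_of_pos abs_numeral)
    also have "\<dots> \<le> integral {t - \<delta>..t + \<delta>} (\<lambda>u. \<epsilon> / 2 + (cmod (F u - P u))\<^sup>2 / \<epsilon>)"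
      using \<epsilon> by (intro integral_norm_bound_integral integrable_continuous_real continuous_intros contP contF FP) auto
    also have "\<dots> = \<delta> * \<epsilon> + integral {t - \<delta>..t + \<delta>} (\<lambda>u. (cmod (F u - P u))\<^sup>2) / \<epsilon>"
      using \<delta> \<epsilon>
      by (subst integral_add) (auto intro!: integrable_continuous_real continuous_intros contP contF)
    also have "integral {t - \<delta>..t + \<delta>} (\<lambda>u. (cmod (F u - P u))\<^sup>2) \<le> integral {b - \<delta>..g + \<delta>} (\<lambda>u. (cmod (F u - P u))\<^sup>2)"
      using t \<delta> by (intro integral_subset_le integrable_continuous_real continuous_intros contP contF) auto
    also have "\<dots> < \<delta> * \<epsilon>\<^sup>2" using L2 by (simp add: F_def P_def)
    also have "\<delta> * \<epsilon> + \<delta> * \<epsilon>\<^sup>2 / \<epsilon> = 2 * \<delta> * \<epsilon>" using \<epsilon> by (simp add: power2_eq_square)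
    finally have "2 * \<delta> * cmod (F t - trig p m (of_real t)) < 2 * \<delta> * \<epsilon>"
      using \<epsilon> by (simp add: divide_right_mono divide_strict_right_mono)
    then show "cmod (trig f N (of_real t) - trig p m (of_real t)) < \<epsilon>" using \<delta> by (simp add: F_def)
  qed
qed

section \<open>Density of rational trigonometric polynomials\<close>

text \<open>Lists over a countable type can be enumerated by \<open>from_nat\<close>. Frequencies
  may repeat, so addition is concatenation.\<close>

definition rat_trig :: "(int \<times> rat \<times> rat) list \<Rightarrow> complex \<Rightarrow> complex" where
  "rat_trig l z = (\<Sum>(k, p, q) \<leftarrow> l. Complex (of_rat p) (of_rat q) * z powi k)"

lemma rat_trig_append: "rat_trig (l @ l') z = rat_trig l z + rat_trig l' z"
  by (simp add: rat_trig_def)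

lemma rat_trig_mult: "\<exists>l''. \<forall>z \<in> unit_circle. rat_trig l'' z = rat_trig l z * rat_trig l' z"
proof (induction l)
  case Nil
  show ?case by (intro exI[of _ "[]"]) (simp add: rat_trig_def)
next
  case (Cons x l)
  obtain k p q where x: "x = (k, p, q)" by (cases x)
  obtain l'' where l'': "\<forall>z \<in> unit_circle. rat_trig l'' z = rat_trig l z * rat_trig l' z" using Cons by blast
  define L where "L = map (\<lambda>(k', p', q'). (k + k', p * p' - q * q', p * q' + q * p')) l'"
  have L: "rat_trig L z = Complex (of_rat p) (of_rat q) * z powi k * rat_trig l' z" if "z \<in> unit_circle" for z
  proof -
    have z: "z \<noteq> 0" using that by auto
    have "rat_trig L z = (\<Sum>(k', p', q') \<leftarrow> l'. Complex (of_rat p) (of_rat q) * z powi k * (Complex (of_rat p') (of_rat q') * z powi k'))"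
      unfolding rat_trig_def L_def using z
      by (simp add: o_def case_prod_unfold of_rat_mult of_rat_diff of_rat_add power_int_add)
        (intro arg_cong[of _ _ sum_list] map_cong refl, simp add: complex_eq_iff algebra_simps)
    then show ?thesis by (simp add: rat_trig_def case_prod_unfold sum_list_const_mult)
  qed
  show ?case
    by (rule exI[of _ "L @ l''"]) (use L l'' in \<open>auto simp: rat_trig_append rat_trig_def x algebra_simps\<close>)
qed

lemma rat_trig_bounded: "\<exists>C. \<forall>z \<in> unit_circle. cmod (rat_trig l z) \<le> C"
proof (induction l)
  case Nil
  show ?case by (auto simp: rat_trig_def)
next
  case (Cons x l)
  obtain k p q where x: "x = (k, p, q)" by (cases x)
  obtain C where C: "\<forall>z \<in> unit_circle. cmod (rat_trig l z) \<le> C" using Cons by blast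
  have "cmod (rat_trig (x # l) z) \<le> cmod (Complex (of_rat p) (of_rat q)) + C" if "z \<in> unit_circle" for z
  proof -
    have "rat_trig (x # l) z = Complex (of_rat p) (of_rat q) * z powi k + rat_trig l z"
      by (simp add: rat_trig_def x)
    then show ?thesis
      using that C norm_triangle_ineq[of "Complex (of_rat p) (of_rat q) * z powi k" "rat_trig l z"]
      by (force simp: norm_mult norm_power_int)
  qed
  then show ?case by blast
qed

text \<open>Membership in the uniform closure on the circle. That this closure is an algebra is what
  connects it to the Stone-Weierstrass theorem for real polynomials in two variables.\<close>

definition rat_approximable :: "(complex \<Rightarrow> complex) \<Rightarrow> bool" where
  "rat_approximable f \<longleftrightarrow> (\<forall>e>0. \<exists>l. \<forall>z \<in> unit_circle. cmod (f z - rat_trig l z) < e)"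

lemma rat_approximable_const: "rat_approximable (\<lambda>z. w)"
  unfolding rat_approximable_def
proof (intro allI impI)
  fix e :: real assume e: "e > 0"
  obtain p where p: "Re w < of_rat p" "of_rat p < Re w + e / 2" using of_rat_dense[of "Re w" "Re w + e / 2"] e by auto
  obtain q where q: "Im w < of_rat q" "of_rat q < Im w + e / 2" using of_rat_dense[of "Im w" "Im w + e / 2"] e by auto
  have "cmod (w - Complex (of_rat p) (of_rat q)) \<le> \<bar>Re w - of_rat p\<bar> + \<bar>Im w - of_rat q\<bar>"
    using cmod_le[of "w - Complex (of_rat p) (of_rat q)"] by simp
  also have "\<dots> < e" using p q by simp
  finally show "\<exists>l. \<forall>z \<in> unit_circle. cmod (w - rat_trig l z) < e"
    by (intro exI[of _ "[(0, p, q)]"]) (simp add: rat_trig_def)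
qed

lemma rat_approximable_powi: "rat_approximable (\<lambda>z. z powi k)"
  unfolding rat_approximable_def
proof (intro allI impI exI[of _ "[(k, 1, 0)]"] ballI)
  fix e :: real and z :: complex assume "e > 0"
  then show "cmod (z powi k - rat_trig [(k, 1, 0)] z) < e"
    by (simp add: rat_trig_def complex_eq_iff[of "Complex 1 0" 1, simplified])
qed

lemma rat_approximable_add:
  assumes "rat_approximable f" "rat_approximable g"
  shows "rat_approximable (\<lambda>z. f z + g z)"
  unfolding rat_approximable_def
proof (intro allI impI)
  fix e :: real assume e: "e > 0"
  obtain l where l: "\<forall>z \<in> unit_circle. cmod (f z - rat_trig l z) < e / 2"
    using assms(1) e unfolding rat_approximable_def by (meson half_gt_zero)
  obtain l' where l': "\<forall>z \<in> unit_circle. cmod (g z - rat_trig l' z) < e / 2"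
    using assms(2) e unfolding rat_approximable_def by (meson half_gt_zero)
  show "\<exists>l. \<forall>z \<in> unit_circle. cmod (f z + g z - rat_trig l z) < e"
  proof (intro exI[of _ "l @ l'"] ballI)
    fix z :: complex assume z: "z \<in> unit_circle"
    show "cmod (f z + g z - rat_trig (l @ l') z) < e"
      using bspec[OF l z] bspec[OF l' z] norm_triangle_ineq[of "f z - rat_trig l z" "g z - rat_trig l' z"]
      by (simp add: rat_trig_append algebra_simps)
  qed
qed

lemma rat_approximable_bounded:
  assumes "rat_approximable f"
  obtains C where "C > 0" "\<forall>z \<in> unit_circle. cmod (f z) \<le> C"
proof -
  obtain l where l: "\<forall>z \<in> unit_circle. cmod (f z - rat_trig l z) < 1"
    using assms unfolding rat_approximable_def by (meson zero_less_one)
  obtain C where C: "\<forall>z \<in> unit_circle. cmod (rat_trig l z) \<le> C" using rat_trig_bounded by blast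
  show thesis
  proof (rule that[of "\<bar>C\<bar> + 1"])
    show "\<forall>z \<in> unit_circle. cmod (f z) \<le> \<bar>C\<bar> + 1"
    proof
      fix z :: complex assume z: "z \<in> unit_circle"
      show "cmod (f z) \<le> \<bar>C\<bar> + 1"
        using bspec[OF l z] bspec[OF C z] norm_triangle_sub[of "f z" "rat_trig l z"] by linarith
    qed
  qed auto
qed

lemma rat_approximable_mult:
  assumes "rat_approximable f" "rat_approximable g"
  shows "rat_approximable (\<lambda>z. f z * g z)"
  unfolding rat_approximable_def
proof (intro allI impI)
  fix e :: real assume e: "e > 0"
  obtain C where C: "C > 0" "\<forall>z \<in> unit_circle. cmod (f z) \<le> C" using rat_approximable_bounded[OF assms(1)] .
  have eC: "e / (2 * C) > 0" using e C by simp
  obtain l' where l': "\<forall>z \<in> unit_circle. cmod (g z - rat_trig l' z) < e / (2 * C)"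
    using assms(2) eC unfolding rat_approximable_def by blast
  obtain C' where C': "\<forall>z \<in> unit_circle. cmod (rat_trig l' z) \<le> C'" using rat_trig_bounded by blast
  have eC': "e / (2 * (\<bar>C'\<bar> + 1)) > 0" using e by simp
  obtain l where l: "\<forall>z \<in> unit_circle. cmod (f z - rat_trig l z) < e / (2 * (\<bar>C'\<bar> + 1))"
    using assms(1) eC' unfolding rat_approximable_def by blast
  obtain l'' where l'': "\<forall>z \<in> unit_circle. rat_trig l'' z = rat_trig l z * rat_trig l' z"
    using rat_trig_mult by blast
  show "\<exists>l. \<forall>z \<in> unit_circle. cmod (f z * g z - rat_trig l z) < e"
  proof (intro exI[of _ l''] ballI)
    fix z :: complex assume z: "z \<in> unit_circle"
    have "f z * g z - rat_trig l'' z = f z * (g z - rat_trig l' z) + (f z - rat_trig l z) * rat_trig l' z"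
      using bspec[OF l'' z] by (simp add: algebra_simps)
    then have "cmod (f z * g z - rat_trig l'' z)
        \<le> cmod (f z) * cmod (g z - rat_trig l' z) + cmod (f z - rat_trig l z) * cmod (rat_trig l' z)"
      by (metis norm_mult norm_triangle_ineq)
    also have "\<dots> \<le> C * cmod (g z - rat_trig l' z) + e / (2 * (\<bar>C'\<bar> + 1)) * (\<bar>C'\<bar> + 1)"
      using bspec[OF C(2) z] bspec[OF C' z] bspec[OF l z] e less_imp_le[OF C(1)] by (intro add_mono mult_mono) auto
    also have "\<dots> < C * (e / (2 * C)) + e / (2 * (\<bar>C'\<bar> + 1)) * (\<bar>C'\<bar> + 1)"
      using bspec[OF l' z] C by (intro add_strict_right_mono mult_strict_left_mono) auto
    also have "\<dots> = e" using C abs_ge_zero[of C'] by (simp add: field_simps)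
    finally show "cmod (f z * g z - rat_trig l'' z) < e" .
  qed
qed

lemma rat_approximable_cong:
  assumes "rat_approximable f" "\<And>z. z \<in> unit_circle \<Longrightarrow> f z = g z"
  shows "rat_approximable g"
  using assms unfolding rat_approximable_def by metis

text \<open>A real linear functional of z is 2 Re (w z) = w z + cnj w cnj z for a suitable w, and
  cnj z = 1 / z on the circle.\<close>

lemma rat_approximable_linear:
  fixes h :: "complex \<Rightarrow> real"
  assumes "bounded_linear h"
  shows "rat_approximable (\<lambda>z. of_real (h z))"
proof (rule rat_approximable_cong)
  define w where "w = Complex (h 1) (- h \<i>) / 2"
  show "rat_approximable (\<lambda>z. w * z powi 1 + cnj w * z powi (- 1))"
    by (intro rat_approximable_add rat_approximable_mult rat_approximable_const rat_approximable_powi)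
  fix z :: complex assume "z \<in> unit_circle"
  then have "cmod z = 1" by simp
  then have "1 / z = cnj z" by (metis complex_div_cnj div_by_1 mult.left_neutral of_real_1 power_one)
  then have z: "inverse z = cnj z" by (simp add: divide_inverse)
  interpret bounded_linear h by fact
  have "h z = h (Re z *\<^sub>R 1 + Im z *\<^sub>R \<i>)" by (rule arg_cong[of _ _ h]) (simp add: complex_eq_iff)
  also have "\<dots> = Re z * h 1 + Im z * h \<i>" unfolding add scaleR by simp
  finally have "h z = Re z * h 1 + Im z * h \<i>" .
  moreover have "w * z + cnj w * cnj z = of_real (Re z * h 1 + Im z * h \<i>)"
    by (simp add: w_def complex_eq_iff field_simps)
  ultimately show "w * z powi 1 + cnj w * z powi (- 1) = of_real (h z)"
    using z by (simp add: power_int_minus)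
qed

lemma rat_approximable_real_polynomial:
  fixes h :: "complex \<Rightarrow> real"
  assumes "real_polynomial_function h"
  shows "rat_approximable (\<lambda>z. of_real (h z))"
  using assms
  by induction (simp_all add: rat_approximable_linear rat_approximable_const rat_approximable_add rat_approximable_mult)

lemma rat_approximable_uniform_limit:
  assumes "\<And>e. e > 0 \<Longrightarrow> \<exists>g. rat_approximable g \<and> (\<forall>z \<in> unit_circle. cmod (f z - g z) < e)"
  shows "rat_approximable f"
  unfolding rat_approximable_def
proof (intro allI impI)
  fix e :: real assume e: "e > 0"
  obtain g where g: "rat_approximable g" "\<forall>z \<in> unit_circle. cmod (f z - g z) < e / 2"
    using assms[of "e / 2"] e by auto
  obtain l where l: "\<forall>z \<in> unit_circle. cmod (g z - rat_trig l z) < e / 2"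
    using g(1) e unfolding rat_approximable_def by (meson half_gt_zero)
  show "\<exists>l. \<forall>z \<in> unit_circle. cmod (f z - rat_trig l z) < e"
  proof (intro exI[of _ l] ballI)
    fix z :: complex assume z: "z \<in> unit_circle"
    show "cmod (f z - rat_trig l z) < e"
      using bspec[OF g(2) z] bspec[OF l z] norm_triangle_ineq[of "f z - g z" "g z - rat_trig l z"] by simp
  qed
qed

lemma rat_approximable_continuous_real:
  fixes h :: "complex \<Rightarrow> real"
  assumes "continuous_on unit_circle h"
  shows "rat_approximable (\<lambda>z. of_real (h z))"
proof (rule rat_approximable_uniform_limit)
  fix e :: real assume "e > 0"
  then obtain p where p: "real_polynomial_function p" "\<And>z. z \<in> unit_circle \<Longrightarrow> \<bar>h z - p z\<bar> < e"
    using Stone_Weierstrass_real_polynomial_function[OF compact_sphere assms] by blast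
  show "\<exists>g. rat_approximable g \<and> (\<forall>z \<in> unit_circle. cmod (of_real (h z) - g z) < e)"
    using p rat_approximable_real_polynomial[OF p(1)]
    by (intro exI[of _ "\<lambda>z. of_real (p z)"]) (auto simp flip: of_real_diff)
qed

lemma rat_approximable_continuous:
  assumes "continuous_on unit_circle f"
  shows "rat_approximable f"
proof (rule rat_approximable_cong)
  show "rat_approximable (\<lambda>z. of_real (Re (f z)) + \<i> * of_real (Im (f z)))"
    using assms
    by (intro rat_approximable_add rat_approximable_mult rat_approximable_const rat_approximable_continuous_real
        continuous_intros)
qed (simp add: complex_eq_iff)

section \<open>Construction of the universal series\<close>

lemma cis_power_int_exp: "cis t powi k = exp (\<i> * of_int k * of_real t)"
  unfolding cis_power_int by (simp add: cis_conv_exp mult_ac)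

lemma trig_partial_sum_cis: "trig_partial_sum a m (cis t) = trig a m (of_real t)"
  unfolding trig_partial_sum_def trig_def
  by (simp add: cis_power_int_exp)

lemma rat_trig_eq_trig:
  "\<exists>f N. (\<forall>n. int N < \<bar>n\<bar> \<longrightarrow> f n = 0) \<and> (\<forall>t. rat_trig l (cis t) = trig f N (of_real t))"
proof (induction l)
    case Nil
    show ?case by (intro exI[of _ "\<lambda>n. 0"] exI[of _ 0]) (simp add: rat_trig_def trig_def)
  next
    case (Cons x l)
    obtain k p q where x: "x = (k, p, q)" by (cases x)
    obtain f N where f: "\<And>n. int N < \<bar>n\<bar> \<Longrightarrow> f n = 0" "\<And>t. rat_trig l (cis t) = trig f N (of_real t)"
      using Cons by blast
    define w where "w = Complex (of_rat p) (of_rat q)"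
    define M where "M = max N (nat \<bar>k\<bar>)"
    define h where "h = (\<lambda>n. (if n = k then w else 0) + f n)"
    have k: "- int M \<le> k \<and> k \<le> int M" by (auto simp: M_def)
    have "rat_trig (x # l) (cis t) = trig h M (of_real t)" for t
    proof -
      have "rat_trig (x # l) (cis t) = w * exp (\<i> * of_int k * of_real t) + rat_trig l (cis t)"
        by (simp add: rat_trig_def x w_def cis_power_int_exp mult.assoc)
      also have "rat_trig l (cis t) = trig f M (of_real t)"
        using trig_extend[of N f M "of_real t"] f by (simp add: M_def)
      also have "w * exp (\<i> * of_int k * of_real t) + trig f M (of_real t) = trig h M (of_real t)"
        using k by (simp add: trig_def h_def distrib_right sum.distrib if_distrib[of "\<lambda>x. x * _"] cong: if_cong)
      finally show ?thesis .
    qed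
    moreover have "h n = 0" if "int M < \<bar>n\<bar>" for n using that f by (auto simp: h_def M_def)
    ultimately show ?case by blast
qed

text \<open>The new block approximates f - a with frequencies beyond K \<ge> m; its support is
  disjoint from that of a, so the coefficient bounds never add up. K \<ge> N is required because
  \<open>uniform_approximation\<close> uses one number both as degree of the target and as
  cut-off.\<close>

lemma universal_coefficients_step:
  fixes a f :: "int \<Rightarrow> complex" and b g \<epsilon> :: real
  assumes c: "c \<in> class_X_plus" and bg: "b < g" "g < b + 2 * pi" and \<epsilon>: "\<epsilon> > 0"
    and a: "\<And>n. cmod (a n) \<le> exp (c (nat \<bar>n\<bar>))" "\<And>n. int m < \<bar>n\<bar> \<Longrightarrow> a n = 0"
    and f: "\<And>n. int N < \<bar>n\<bar> \<Longrightarrow> f n = 0"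
  obtains a' m' where "m < m'" "\<forall>n. \<bar>n\<bar> \<le> int m \<longrightarrow> a' n = a n"
    "\<forall>n. cmod (a' n) \<le> exp (c (nat \<bar>n\<bar>))" "\<forall>n. int m' < \<bar>n\<bar> \<longrightarrow> a' n = 0"
    "\<forall>t \<in> {b..g}. cmod (trig f N (of_real t) - trig a' m' (of_real t)) < \<epsilon>"
proof -
  define K where "K = max N m"
  obtain p M where p: "p \<in> admissible c K M"
    and pf: "\<forall>t \<in> {b..g}. cmod (trig (\<lambda>n. f n - a n) K (of_real t) - trig p M (of_real t)) < \<epsilon>"
    by (rule uniform_approximation[OF c bg \<epsilon>, where f = "\<lambda>n. f n - a n" and N = K])
  \<comment> \<open>The successor forces m < m' even when the block is zero.\<close>
  define m' where "m' = Suc (max M K)"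
  have p0: "p n = 0" if "\<bar>n\<bar> \<le> int m" for n
  proof (rule ccontr)
    assume "p n \<noteq> 0"
    then have "int K < \<bar>n\<bar>" using p by (auto simp: admissible_def)
    then show False using that by (simp add: K_def)
  qed
  show thesis
  proof (rule that[of m' "\<lambda>n. a n + p n"]; (intro allI impI ballI)?)
    show "m < m'" by (simp add: m'_def K_def)
    show "a n + p n = a n" if "\<bar>n\<bar> \<le> int m" for n using p0[OF that] by simp
    show "cmod (a n + p n) \<le> exp (c (nat \<bar>n\<bar>))" for n
      using a p0[of n] p by (cases "\<bar>n\<bar> \<le> int m") (auto simp: admissible_def)
    show "a n + p n = 0" if "int m' < \<bar>n\<bar>" for n
    proof -
      have "p n = 0"
      proof (rule ccontr)
        assume "p n \<noteq> 0"
        then have "\<bar>n\<bar> \<le> int M" using p by (auto simp: admissible_def)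
        then show False using that by (simp add: m'_def)
      qed
      then show ?thesis using a(2)[of n] that by (simp add: m'_def K_def)
    qed
    fix t assume "t \<in> {b..g}"
    have K: "N \<le> K" "m \<le> K" "K \<le> m'" by (auto simp: m'_def K_def)
    have "trig f m' (of_real t) = trig f N (of_real t)" "trig f m' (of_real t) = trig f K (of_real t)"
      "trig a m' (of_real t) = trig a K (of_real t)"
      by (rule trig_extend; use a(2) f K in simp)+
    moreover have "trig p M (of_real t) = trig p m' (of_real t)"
      using trig_admissible_extend[OF p, of m' "of_real t"] by (simp add: m'_def)
    moreover have "trig (\<lambda>n. a n + p n) m' (of_real t) = trig a m' (of_real t) + trig p m' (of_real t)"
      by (simp add: trig_def distrib_right sum.distrib)
    ultimately have "trig f N (of_real t) - trig (\<lambda>n. a n + p n) m' (of_real t)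
        = trig (\<lambda>n. f n - a n) K (of_real t) - trig p M (of_real t)"
      unfolding trig_diff by simp
    then show "cmod (trig f N (of_real t) - trig (\<lambda>n. a n + p n) m' (of_real t)) < \<epsilon>"
      using bspec[OF pf \<open>t \<in> {b..g}\<close>] by simp
  qed
qed

theorem theorem1p7:
  fixes c :: "nat \<Rightarrow> real"
  assumes "c \<in> class_X_plus"
  shows "\<exists>a :: int \<Rightarrow> complex.
           (\<forall>n. cmod (a n) \<le> exp (c (nat \<bar>n\<bar>)))
         \<and> universal_trig_series a
         \<and> limit_functions a = C_circle"
proof -
  note c = assms
  \<comment> \<open>The ignored first component makes each list occur at infinitely many k, so every
    target can be approached at arbitrarily late steps.\<close>
  define T where "T = (\<lambda>k. rat_trig (snd (from_nat k :: nat \<times> (int \<times> rat \<times> rat) list)))"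
  \<comment> \<open>The exceptional arcs 1 / (k + 2) < t < 1 / (k + 1) are pairwise disjoint and
    omit the point 1, which is the angle 2 pi.\<close>
  define I where "I = (\<lambda>k. {1 / (real k + 1)..1 / (real k + 2) + 2 * pi})"
  define P where "P = (\<lambda>(k::nat) (x :: nat \<times> (int \<Rightarrow> complex)). (\<forall>n. cmod (snd x n) \<le> exp (c (nat \<bar>n\<bar>)))
    \<and> (\<forall>n. int (fst x) < \<bar>n\<bar> \<longrightarrow> snd x n = 0))"
  define R where "R = (\<lambda>k (x :: nat \<times> (int \<Rightarrow> complex)) y. fst x < fst y \<and> (\<forall>n. \<bar>n\<bar> \<le> int (fst x) \<longrightarrow> snd y n = snd x n)
    \<and> (\<forall>t \<in> I k. cmod (T k (cis t) - trig (snd y) (fst y) (of_real t)) < 1 / (real k + 1)))"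
  have "\<exists>x. \<forall>k. P k (x k) \<and> R k (x k) (x (Suc k))"
  proof (rule dependent_nat_choice)
    show "\<exists>x. P 0 x" by (intro exI[of _ "(0, \<lambda>n. 0)"]) (simp add: P_def)
    fix x k assume x: "P k x"
    obtain f N where f: "\<And>n. int N < \<bar>n\<bar> \<Longrightarrow> f n = 0" "\<And>t. T k (cis t) = trig f N (of_real t)"
      using rat_trig_eq_trig[of "snd (from_nat k)"] unfolding T_def by blast
    have "1 / (real k + 1) \<le> 1" "1 / (real k + 2) > 0" "1 / (real k + 2) < 1 / (real k + 1)"
      by (simp_all add: frac_less2)
    then have I: "1 / (real k + 1) < 1 / (real k + 2) + 2 * pi"
      "1 / (real k + 2) + 2 * pi < 1 / (real k + 1) + 2 * pi"
      using pi_gt3 by linarith+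
    have pos: "1 / (real k + 1) > 0" by simp
    have xa: "\<And>n. cmod (snd x n) \<le> exp (c (nat \<bar>n\<bar>))" "\<And>n. int (fst x) < \<bar>n\<bar> \<Longrightarrow> snd x n = 0"
      using x by (auto simp: P_def)
    obtain a' m' where "fst x < m'" "\<forall>n. \<bar>n\<bar> \<le> int (fst x) \<longrightarrow> a' n = snd x n"
      "\<forall>n. cmod (a' n) \<le> exp (c (nat \<bar>n\<bar>))" "\<forall>n. int m' < \<bar>n\<bar> \<longrightarrow> a' n = 0"
      "\<forall>t \<in> {1 / (real k + 1)..1 / (real k + 2) + 2 * pi}.
        cmod (trig f N (of_real t) - trig a' m' (of_real t)) < 1 / (real k + 1)"
      by (rule universal_coefficients_step[OF c I pos xa f(1)])
    then show "\<exists>y. P (Suc k) y \<and> R k x y"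
      by (intro exI[of _ "(m', a')"]) (simp add: P_def R_def I_def f(2))
  qed
  then obtain x where xP: "\<And>k. P k (x k)" and xR: "\<And>k. R k (x k) (x (Suc k))" by blast
  define m where "m = (\<lambda>k. fst (x k))"
  have sm: "strict_mono m" unfolding strict_mono_Suc_iff using xR by (simp add: m_def R_def)
  have stable: "snd (x k') n = snd (x k) n" if "k \<le> k'" "\<bar>n\<bar> \<le> int (m k)" for k k' n
    using that(1)
  proof (induction k' rule: dec_induct)
    case (step j)
    have "\<bar>n\<bar> \<le> int (m j)" using that(2) strict_mono_less_eq[OF sm, of k j] step.hyps by simp
    then show ?case using xR[of j] step.IH by (simp add: R_def m_def)
  qed simp
  \<comment> \<open>Since m is strictly increasing, m j \<ge> j, so the coefficient at n is final
    from step \<bar>n\<bar> on.\<close>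
  define A where "A = (\<lambda>n. snd (x (nat \<bar>n\<bar>)) n)"
  have A: "A n = snd (x k) n" if "\<bar>n\<bar> \<le> int (m k)" for n k
  proof -
    have "nat \<bar>n\<bar> \<le> m (nat \<bar>n\<bar>)" using sm by (rule strict_mono_imp_increasing)
    then have n: "\<bar>n\<bar> \<le> int (m (nat \<bar>n\<bar>))" by linarith
    show ?thesis
      using stable[of k "nat \<bar>n\<bar>" n] stable[of "nat \<bar>n\<bar>" k n] n that by (cases "k \<le> nat \<bar>n\<bar>") (auto simp: A_def)
  qed
  have close: "cmod (T k (cis t) - trig_partial_sum A (m (Suc k)) (cis t)) < 1 / (real k + 1)" if "t \<in> I k" for k t
  proof -
    have "trig_partial_sum A (m (Suc k)) (cis t) = trig (snd (x (Suc k))) (m (Suc k)) (of_real t)"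
      unfolding trig_partial_sum_cis trig_def using A[of _ "Suc k"] by (intro sum.cong refl) auto
    then show ?thesis using xR[of k] that by (simp add: R_def m_def)
  qed
  have cover: "\<exists>k0. \<forall>k > k0. cmod (T k z - trig_partial_sum A (m (Suc k)) z) < 1 / (real k + 1)"
    if z: "z \<in> unit_circle" for z
  proof -
    \<comment> \<open>The angle is normalised to be positive, with 2 pi in place of 0: then t
      exceeds 1 / (k + 1) for all large k.\<close>
    obtain t where t: "0 < t" "t \<le> 2 * pi" "z = cis t"
    proof (cases "Arg2pi z = 0")
      case True
      then have "z = cis (2 * pi)" using z Arg2pi_eq[of z] by simp
      then show thesis using that[of "2 * pi"] by simp
    next
      case False
      have "z = cis (Arg2pi z)" using z Arg2pi_eq[of z] by (simp add: cis_conv_exp)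
      then show thesis using that[of "Arg2pi z"] False Arg2pi_ge_0[of z] Arg2pi_lt_2pi[of z] by simp
    qed
    obtain k0 where k0: "1 / (real k0 + 1) < t" using reals_Archimedean[OF t(1)] by (auto simp: inverse_eq_divide add.commute)
    show ?thesis
    proof (intro exI[of _ k0] allI impI)
      fix k assume "k > k0"
      then have "1 / (real k + 1) \<le> 1 / (real k0 + 1)" by (intro divide_left_mono) auto
      then have "t \<in> I k" using t k0 by (auto simp: I_def intro: order_trans add_increasing)
      then show "cmod (T k z - trig_partial_sum A (m (Suc k)) z) < 1 / (real k + 1)" using close t(3) by simp
    qed
  qed
  have bound: "cmod (A n) \<le> exp (c (nat \<bar>n\<bar>))" for n using xP by (simp add: A_def P_def)
  have univ: "f \<in> limit_functions A" if f: "f \<in> C_circle" for f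
  proof -
    have cont: "continuous_on unit_circle f" using f by (simp add: C_circle_def)
    have ex: "\<exists>k>K. \<forall>z \<in> unit_circle. cmod (f z - T k z) < e" if e: "e > 0" for K :: nat and e
    proof -
      obtain l where l: "\<forall>z \<in> unit_circle. cmod (f z - rat_trig l z) < e"
        using rat_approximable_continuous[OF cont] e unfolding rat_approximable_def by blast
      have "inj (\<lambda>j::nat. to_nat (j, l))" by (simp add: inj_on_def)
      then have "infinite (range (\<lambda>j::nat. to_nat (j, l)))" by (rule range_inj_infinite)
      then obtain j where "to_nat (j :: nat, l) > K" by (auto simp: infinite_nat_iff_unbounded)
      then show ?thesis using l by (intro exI[of _ "to_nat (j, l)"]) (simp add: T_def)
    qed
    have "\<exists>\<kappa>. \<forall>i. (\<forall>z \<in> unit_circle. cmod (f z - T (\<kappa> i) z) < 1 / (real i + 1)) \<and> \<kappa> i < \<kappa> (Suc i)"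
    proof (rule dependent_nat_choice)
      show "\<exists>k. \<forall>z \<in> unit_circle. cmod (f z - T k z) < 1 / (real 0 + 1)" using ex[of 1 0] by auto
      show "\<exists>k'. (\<forall>z \<in> unit_circle. cmod (f z - T k' z) < 1 / (real (Suc i) + 1)) \<and> k < k'" for k i
        using ex[of "1 / (real (Suc i) + 1)" k] by (auto simp del: of_nat_Suc)
    qed
    then obtain \<kappa> where \<kappa>: "\<And>i z. z \<in> unit_circle \<Longrightarrow> cmod (f z - T (\<kappa> i) z) < 1 / (real i + 1)"
      and \<kappa>mono: "strict_mono \<kappa>" unfolding strict_mono_Suc_iff by blast
    define M where "M = (\<lambda>i. m (Suc (\<kappa> i)))"
    have "strict_mono M" unfolding M_def using sm \<kappa>mono by (simp add: strict_mono_def)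
    moreover have "0 < M i" for i unfolding M_def using strict_monoD[OF sm, of 0 "Suc (\<kappa> i)"] by simp
    moreover have "(\<lambda>i. trig_partial_sum A (M i) z) \<longlonglongrightarrow> f z" if z: "z \<in> unit_circle" for z
    proof -
      obtain k0 where k0: "\<And>k. k > k0 \<Longrightarrow> cmod (T k z - trig_partial_sum A (m (Suc k)) z) < 1 / (real k + 1)"
        using cover[OF z] by blast
      have "eventually (\<lambda>i. norm (trig_partial_sum A (M i) z - f z) \<le> 2 / (real i + 1)) sequentially"
        using eventually_gt_at_top[of k0]
      proof eventually_elim
        case (elim i)
        have i: "i \<le> \<kappa> i" using \<kappa>mono by (rule strict_mono_imp_increasing)
        then have "cmod (T (\<kappa> i) z - trig_partial_sum A (M i) z) < 1 / (real (\<kappa> i) + 1)"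
          unfolding M_def using elim by (intro k0) simp
        also have "\<dots> \<le> 1 / (real i + 1)" using i by (intro divide_left_mono) auto
        finally show ?case
          using \<kappa>[OF z, of i] norm_triangle_ineq[of "f z - T (\<kappa> i) z" "T (\<kappa> i) z - trig_partial_sum A (M i) z"]
          by (simp add: norm_minus_commute)
      qed
      moreover have "(\<lambda>i. 2 / (real i + 1)) \<longlonglongrightarrow> 0" by real_asymp
      ultimately have "(\<lambda>i. trig_partial_sum A (M i) z - f z) \<longlonglongrightarrow> 0" by (rule Lim_null_comparison)
      then show ?thesis by (simp add: LIM_zero_iff)
    qed
    ultimately show ?thesis using f unfolding limit_functions_def by blast
  qed
  have "limit_functions A = C_circle" using univ by (auto simp: limit_functions_def)
  moreover have "universal_trig_series A" using univ by (simp add: universal_trig_series_def)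
  ultimately show ?thesis using bound by blast
qed

end
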